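(* Let $\Omega\subset\mathbb{R}^d$ be open and bounded, $\Gamma\subset\mathbb{R}^s$ compact, $U:=\Omega\times\Gamma$. Let $f:U\times\mathbb{R}^{d,s}\to[0,\infty]$ be lower semicontinuous (jointly) in both variables, convex in the second variable, such that $t\mapsto f(t,0)$ is locally bounded, and such that its conjugate $f^*$ is continuous with $$\sup_{t\in U,\ \|\xi\|<r}|f^*(t,\xi)|<\infty\qquad\forall r>0.$$ For $\mu\in\mathcal{M}(U)$ define $$\mathcal{F}(\mu):=\inf\Big\{\mathfrak{B}_f((E,\mu)) : E\in\mathcal{M}(U,\mathbb{R}^{d,s}),\ \int_U\operatorname{div}_x\phi\,\mathrm{d}\mu+\int_U\langle\nabla_z\phi^{\top},\mathrm{d}E\rangle=0\ \ \forall\phi\in C_c^1(\Omega\times\Gamma,\mathbb{R}^d)\Big\}.$$ Then for every $u\in C^1(\Omega,\Gamma)$ with $F(u):=\int_\Omega f(x,u(x),\nabla u(x))\,\mathrm{d}x<\infty$ one has $$\mathcal{F}(\delta_u)=F(u).$$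
   Context: Points of $U$ are written $t=(x,z)$ with $x\in\Omega$, $z\in\Gamma$, and $f(t,p)=f(x,z,p)$; derivatives with index $x$ (resp. $z$) are with respect to the $\Omega$- (resp. $\Gamma$-) variable. $C_0(U,\mathbb{R}^k)$ is the closure in the supremum norm of the compactly supported continuous functions; $\mathcal{M}(U,\mathbb{R}^k)$ is the space of (finite) $\mathbb{R}^k$-valued Radon measures on $U$, $\mathcal{M}(U)=\mathcal{M}(U,\mathbb{R})$. The graph-concentrated measure $\delta_u$ is defined by $\int_U\phi\,\mathrm{d}\delta_u:=\int_\Omega\phi(x,u(x))\,\mathrm{d}x$ for all $\phi\in C_0(U,\mathbb{R})$. The infimum of the empty set is $+\infty$. $\mathbb{R}^{d,s}$ denotes real $d\times s$ matrices with the Frobenius inner product; $(\nabla u)_{i,k}=\partial_{x_i}u_k$ and $(\nabla_z\phi^{\top})_{i,k}=\partial_{z_k}\phi_i$. $C_c^1(\Omega\times\Gamma,\mathbb{R}^d)$ denotes continuously differentiable functions with compact support in the first variable; concretely, functions $\phi$ of class $C^1$ on $\Omega\times\mathbb{R}^s$ for which there is a compact $K\subset\Omega$ with $\phi(x,z)=0$ for $x\notin K$, used on $\Omega\times\Gamma$. Conjugate in the last variable: $f^*(t,\xi):=\sup_{p}\langle\xi,p\rangle-f(t,p)$. The generalized Benamou-Brenier functional is, for $(E,\mu)\in\mathcal{M}(U,\mathbb{R}^{d,s}\times\mathbb{R})$, $$\mathfrak{B}_f((E,\mu)):=\sup_{(\phi^\xi,\phi^\lambda)\in\mathcal{K}_f}\int_U\langle\phi^\xi,\mathrm{d}E\rangle+\int_U\phi^\lambda\,\mathrm{d}\mu,$$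 $$\mathcal{K}_f:=\{(\phi^{\xi},\phi^{\lambda})\in C_0(U,\mathbb{R}^{d,s}\times\mathbb{R}) : f^*(t,\phi^{\xi}(t))+\phi^{\lambda}(t)\le 0\ \ \forall t\in U\}.$$ *)

theory Defs
  imports "HOL-Analysis.Analysis"
begin

text \<open>
  The matrices $\mathbb{R}^{d,s}$ are rendered as the type \<^typ>\<open>real^'s^'d\<close> (entry $(i,k)$
  is \<open>p $ i $ k\<close>); its library inner product and norm are the Frobenius ones.
\<close>

subsection \<open>Finite vector-valued measures\<close>

text \<open>
  Vector measures are countably additive set functions on the Borel subsets of \<open>S\<close>. The sets \<open>S\<close>
  of interest (open times compact in a Euclidean space) are locally compact, $\sigma$-compact and
  metrizable, so that every such (automatically finite) measure is Radon. Values outside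
  the Borel $\sigma$-algebra of \<open>S\<close> are irrelevant.
\<close>

definition vector_measures ::
  "'a::topological_space set \<Rightarrow> ('a set \<Rightarrow> 'b::real_normed_vector) set" where
  "vector_measures S = {\<nu>. \<nu> {} = 0 \<and>
     (\<forall>A :: nat \<Rightarrow> 'a set. range A \<subseteq> sets (restrict_space borel S) \<longrightarrow> disjoint_family A \<longrightarrow>
        (\<lambda>n. \<nu> (A n)) sums \<nu> (\<Union>n. A n))}"

text \<open>
  Positive part of the Jordan decomposition, $\nu^+(A) = \sup_{B \subseteq A} \nu(B)$; the coercion
  \<^const>\<open>ennreal\<close> truncates negative values, which is harmless because of $B = \emptyset$. The
  negative part of $\nu$ is the positive part of $-\nu$.
\<close>

definition pos_variation ::
  "'a::topological_space set \<Rightarrow> ('a set \<Rightarrow> real) \<Rightarrow> 'a measure" where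
  "pos_variation S \<nu> = measure_of S (sets (restrict_space borel S))
     (\<lambda>A. SUP B\<in>{B \<in> sets (restrict_space borel S). B \<subseteq> A}. ennreal (\<nu> B))"

definition signed_integral ::
  "'a::topological_space set \<Rightarrow> ('a \<Rightarrow> real) \<Rightarrow> ('a set \<Rightarrow> real) \<Rightarrow> real" where
  "signed_integral S h \<nu> =
     integral\<^sup>L (pos_variation S \<nu>) h - integral\<^sup>L (pos_variation S (\<lambda>A. - \<nu> A)) h"

text \<open>The pairing $\int_S \langle \phi, \mathrm{d}\nu\rangle$, computed componentwise.\<close>

definition pairing_integral ::
  "'a::topological_space set \<Rightarrow> ('a \<Rightarrow> 'b::euclidean_space) \<Rightarrow> ('a set \<Rightarrow> 'b) \<Rightarrow> real" where
  "pairing_integral S \<phi> \<nu> =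
     (\<Sum>b\<in>Basis. signed_integral S (\<lambda>t. \<phi> t \<bullet> b) (\<lambda>A. \<nu> A \<bullet> b))"


subsection \<open>Function spaces\<close>

definition Cc_space :: "'a::topological_space set \<Rightarrow> ('a \<Rightarrow> 'b::real_normed_vector) set" where
  "Cc_space S = {\<phi>. continuous_on S \<phi> \<and> (\<exists>K. compact K \<and> K \<subseteq> S \<and> (\<forall>t\<in>S - K. \<phi> t = 0))}"

definition C0_space :: "'a::topological_space set \<Rightarrow> ('a \<Rightarrow> 'b::real_normed_vector) set" where
  "C0_space S = {\<phi>. \<exists>\<psi> :: nat \<Rightarrow> 'a \<Rightarrow> 'b.
     (\<forall>n. \<psi> n \<in> Cc_space S) \<and> uniform_limit S \<psi> \<phi> sequentially}"

text \<open>Intended for open \<open>S\<close>.\<close>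

definition C1_on ::
  "('a::real_normed_vector \<Rightarrow> 'b::real_normed_vector) \<Rightarrow> 'a set \<Rightarrow> bool" where
  "C1_on g S \<longleftrightarrow> (\<exists>g' :: 'a \<Rightarrow> 'a \<Rightarrow>\<^sub>L 'b.
     (\<forall>x\<in>S. (g has_derivative blinfun_apply (g' x)) (at x)) \<and> continuous_on S g')"

text \<open>
  Test functions of class $C^1$ on $\Omega \times \mathbb{R}^s$ with compact support in the first
  variable.
\<close>

definition test_functions ::
  "(real^'d) set \<Rightarrow> ((real^'d) \<times> (real^'s) \<Rightarrow> real^'d) set" where
  "test_functions \<Omega> = {\<phi>. C1_on \<phi> (\<Omega> \<times> UNIV) \<and>
     (\<exists>K. compact K \<and> K \<subseteq> \<Omega> \<and> (\<forall>x\<in>\<Omega> - K. \<forall>z. \<phi> (x, z) = 0))}"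

definition lsc_on :: "'a::topological_space set \<Rightarrow> ('a \<Rightarrow> ennreal) \<Rightarrow> bool" where
  "lsc_on S g \<longleftrightarrow> (\<forall>x\<in>S. g x \<le> Liminf (at x within S) g)"

definition convex_ennreal :: "('a::real_vector \<Rightarrow> ennreal) \<Rightarrow> bool" where
  "convex_ennreal g \<longleftrightarrow> (\<forall>p q \<theta>. 0 \<le> \<theta> \<longrightarrow> \<theta> \<le> 1 \<longrightarrow>
     g ((1 - \<theta>) *\<^sub>R p + \<theta> *\<^sub>R q) \<le> ennreal (1 - \<theta>) * g p + ennreal \<theta> * g q)"

definition locally_bounded_on :: "'a::topological_space set \<Rightarrow> ('a \<Rightarrow> ennreal) \<Rightarrow> bool" where
  "locally_bounded_on S g \<longleftrightarrow>
     (\<forall>t\<in>S. \<exists>V C. open V \<and> t \<in> V \<and> (\<forall>t'\<in>S \<inter> V. g t' \<le> ennreal C))"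


subsection \<open>Differential operators\<close>

definition grad :: "(real^'d \<Rightarrow> real^'s) \<Rightarrow> real^'d \<Rightarrow> real^'s^'d" where
  "grad u x = (\<chi> i k. frechet_derivative u (at x) (axis i 1) $ k)"

definition div_x :: "((real^'d) \<times> (real^'s) \<Rightarrow> real^'d) \<Rightarrow> (real^'d) \<times> (real^'s) \<Rightarrow> real" where
  "div_x \<phi> t = (\<Sum>i\<in>UNIV. frechet_derivative \<phi> (at t) (axis i 1, 0) $ i)"

text \<open>$(\nabla_z \phi^\top)_{i,k} = \partial_{z_k} \phi_i$\<close>

definition grad_z ::
  "((real^'d) \<times> (real^'s) \<Rightarrow> real^'d) \<Rightarrow> (real^'d) \<times> (real^'s) \<Rightarrow> real^'s^'d" where
  "grad_z \<phi> t = (\<chi> i k. frechet_derivative \<phi> (at t) (0, axis k 1) $ i)"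


subsection \<open>The functionals\<close>

definition conj_last :: "('t \<Rightarrow> 'p::real_inner \<Rightarrow> ennreal) \<Rightarrow> 't \<Rightarrow> 'p \<Rightarrow> ereal" where
  "conj_last f t \<xi> = (SUP p. ereal (\<xi> \<bullet> p) - enn2ereal (f t p))"

definition BB_admissible ::
  "'t::topological_space set \<Rightarrow> ('t \<Rightarrow> 'p::euclidean_space \<Rightarrow> ennreal) \<Rightarrow> ('t \<Rightarrow> 'p \<times> real) set" where
  "BB_admissible U f =
     {\<phi> \<in> C0_space U. \<forall>t\<in>U. conj_last f t (fst (\<phi> t)) + ereal (snd (\<phi> t)) \<le> 0}"

definition BB_functional ::
  "'t::topological_space set \<Rightarrow> ('t \<Rightarrow> 'p::euclidean_space \<Rightarrow> ennreal) \<Rightarrow>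
     ('t set \<Rightarrow> 'p) \<times> ('t set \<Rightarrow> real) \<Rightarrow> ereal" where
  "BB_functional U f = (\<lambda>(E, \<mu>). SUP \<phi>\<in>BB_admissible U f.
     ereal (pairing_integral U (\<lambda>t. fst (\<phi> t)) E + signed_integral U (\<lambda>t. snd (\<phi> t)) \<mu>))"

definition lifted_functional ::
  "(real^'d) set \<Rightarrow> (real^'s) set \<Rightarrow> ((real^'d) \<times> (real^'s) \<Rightarrow> real^'s^'d \<Rightarrow> ennreal) \<Rightarrow>
     (((real^'d) \<times> (real^'s)) set \<Rightarrow> real) \<Rightarrow> ereal" where
  "lifted_functional \<Omega> \<Gamma> f \<mu> = (INF E\<in>{E \<in> vector_measures (\<Omega> \<times> \<Gamma>). \<forall>\<phi>\<in>test_functions \<Omega>.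
       signed_integral (\<Omega> \<times> \<Gamma>) (div_x \<phi>) \<mu> + pairing_integral (\<Omega> \<times> \<Gamma>) (grad_z \<phi>) E = 0}.
     BB_functional (\<Omega> \<times> \<Gamma>) f (E, \<mu>))"

definition energy ::
  "(real^'d) set \<Rightarrow> ((real^'d) \<times> (real^'s) \<Rightarrow> real^'s^'d \<Rightarrow> ennreal) \<Rightarrow>
     (real^'d \<Rightarrow> real^'s) \<Rightarrow> ennreal" where
  "energy \<Omega> f u = (\<integral>\<^sup>+x\<in>\<Omega>. f (x, u x) (grad u x) \<partial>lborel)"

text \<open>
  The measure $\delta_u$ concentrated on the graph of \<open>u\<close>, as the image of Lebesgue measure on
  $\Omega$ under $x \mapsto (x, u(x))$; see \<open>signed_integral_graph_measure\<close> for its defining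
  property.
\<close>

definition graph_measure ::
  "(real^'d) set \<Rightarrow> (real^'s) set \<Rightarrow> (real^'d \<Rightarrow> real^'s) \<Rightarrow>
     ((real^'d) \<times> (real^'s)) set \<Rightarrow> real" where
  "graph_measure \<Omega> \<Gamma> u = measure (distr (restrict_space lborel \<Omega>)
     (restrict_space borel (\<Omega> \<times> \<Gamma>)) (\<lambda>x. (x, u x)))"


subsection \<open>Consistency of the definitions\<close>

lemma vector_measures_measure:
  assumes "finite_measure M" "sets M = sets (restrict_space borel S)"
  shows "measure M \<in> vector_measures S"
  using finite_measure.finite_measure_UNION[OF assms(1)] assms(2)
  by (auto simp: vector_measures_def)

lemma pos_variation_measure:
  assumes "finite_measure M" "sets M = sets (restrict_space borel S)"
  shows "pos_variation S (measure M) = M"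
    and "pos_variation S (\<lambda>A. - measure M A) = null_measure M"
proof -
  interpret finite_measure M by fact
  have sp: "space M = S"
    using sets_eq_imp_space_eq[OF assms(2)] by (simp add: space_restrict_space)
  have 1: "(SUP B\<in>{B \<in> sets M. B \<subseteq> A}. ennreal (measure M B)) = emeasure M A" if "A \<in> sets M" for A
    using that by (intro antisym SUP_least SUP_upper2[of A])
      (auto simp: emeasure_eq_measure intro!: ennreal_leI finite_measure_mono)
  have 2: "(SUP B\<in>{B \<in> sets M. B \<subseteq> A}. ennreal (- measure M B)) = 0" for A
    by (intro antisym SUP_least) (auto simp: ennreal_neg)
  have "measure_of S (sets M) (\<lambda>A. SUP B\<in>{B \<in> sets M. B \<subseteq> A}. ennreal (measure M B))
      = measure_of S (sets M) (emeasure M)"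
    using 1 sp by (intro measure_of_eq) (auto simp: sets.sets_measure_of_eq sets.space_closed sp[symmetric] sets.sigma_sets_eq)
  then show "pos_variation S (measure M) = M"
    unfolding pos_variation_def assms(2)[symmetric]
    by (simp add: sp[symmetric] measure_of_of_measure)
  show "pos_variation S (\<lambda>A. - measure M A) = null_measure M"
    unfolding pos_variation_def assms(2)[symmetric] 2
    by (rule measure_eqI) (auto simp: sp[symmetric] emeasure_sigma)
qed

lemma signed_integral_measure:
  assumes "finite_measure M" "sets M = sets (restrict_space borel S)"
  shows "signed_integral S h (measure M) = integral\<^sup>L M h"
  by (simp add: signed_integral_def pos_variation_measure[OF assms])

lemma C0_space_continuous_on: "\<phi> \<in> C0_space S \<Longrightarrow> continuous_on S \<phi>"
  unfolding C0_space_def Cc_space_def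
  by (auto intro!: uniform_limit_theorem[where F = sequentially])

lemma
  fixes u :: "real^'d \<Rightarrow> real^'s"
  assumes "open \<Omega>" "bounded \<Omega>" "continuous_on \<Omega> u" "u ` \<Omega> \<subseteq> \<Gamma>"
  shows graph_measure_vector_measures: "graph_measure \<Omega> \<Gamma> u \<in> vector_measures (\<Omega> \<times> \<Gamma>)"
    and signed_integral_graph_measure:
      "\<phi> \<in> C0_space (\<Omega> \<times> \<Gamma>) \<Longrightarrow>
        signed_integral (\<Omega> \<times> \<Gamma>) \<phi> (graph_measure \<Omega> \<Gamma> u) = (LINT x:\<Omega>|lborel. \<phi> (x, u x))"
proof -
  let ?R = "restrict_space lborel \<Omega>"
  let ?D = "distr ?R (restrict_space borel (\<Omega> \<times> \<Gamma>)) (\<lambda>x. (x, u x))"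
  have \<Omega>: "\<Omega> \<in> sets lborel"
    using assms(1) by simp
  have "(\<lambda>x. (x, u x)) \<in> borel_measurable (restrict_space borel \<Omega>)"
    using assms(3) by (intro borel_measurable_continuous_on_restrict continuous_intros)
  then have meas: "(\<lambda>x. (x, u x)) \<in> measurable ?R (restrict_space borel (\<Omega> \<times> \<Gamma>))"
    using assms(4)
    by (intro measurable_restrict_space2)
      (auto simp: space_restrict_space cong: measurable_cong_sets sets_restrict_space_cong)
  have "emeasure lborel \<Omega> < \<infinity>"
    using assms(2) by (rule emeasure_bounded_finite)
  then have "finite_measure ?R"
    using \<Omega> by (intro finite_measureI) (auto simp: space_restrict_space emeasure_restrict_space)
  then have fin: "finite_measure ?D"
    using meas by (rule finite_measure.finite_measure_distr)
  show "graph_measure \<Omega> \<Gamma> u \<in> vector_measures (\<Omega> \<times> \<Gamma>)"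
    unfolding graph_measure_def using fin by (rule vector_measures_measure) simp
  assume "\<phi> \<in> C0_space (\<Omega> \<times> \<Gamma>)"
  then have "\<phi> \<in> borel_measurable (restrict_space borel (\<Omega> \<times> \<Gamma>))"
    by (intro borel_measurable_continuous_on_restrict C0_space_continuous_on)
  then have "integral\<^sup>L ?D \<phi> = (\<integral>x. \<phi> (x, u x) \<partial>?R)"
    using meas by (intro integral_distr)
  also have "\<dots> = (LINT x:\<Omega>|lborel. \<phi> (x, u x))"
    using \<Omega> by (simp add: integral_restrict_space set_lebesgue_integral_def)
  finally show "signed_integral (\<Omega> \<times> \<Gamma>) \<phi> (graph_measure \<Omega> \<Gamma> u) = (LINT x:\<Omega>|lborel. \<phi> (x, u x))"
    unfolding graph_measure_def using fin by (simp add: signed_integral_measure)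
qed

end

theory Submission
  imports Defs
begin

text \<open>
  For the upper bound, take \<open>E = grad u\<close> times the graph measure: the constraint becomes the divergence
  theorem for \<open>x \<mapsto> \<phi> (x, u x)\<close>, and the bound is the Fenchel inequality.

  For the lower bound no structure of a competitor \<open>\<nu>\<close> is needed. Testing the constraint with
  \<open>\<phi> (x, z) = A x *v (z - u x)\<close> gives \<open>\<integral> \<langle>A x, d\<nu>\<rangle> = \<integral> \<langle>A x, grad u x\<rangle> dx\<close> for every \<open>A\<close> of class
  \<open>C\<^sup>1\<close> with compact support. If \<open>v i\<close> are nonnegative \<open>C\<^sup>1\<close> weights with compact support and sum at most 1,
  then \<open>(\<Sum>i. v i *\<^sub>R \<Xi> i, - \<Sum>i. v i * f\<^sup>* (\<cdot>, \<Xi> i))\<close> is admissible because \<open>f \<ge> 0\<close>, so the functional is at least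
  \<open>\<integral> \<Sum>i. v i * h i\<close> with \<open>h i x = \<Xi> i \<bullet> grad u x - f\<^sup>* (x, u x, \<Xi> i)\<close>. Since the \<open>h i\<close> are continuous,
  such weights can concentrate on the maximal \<open>h i\<close>; with \<open>\<Xi>\<close> dense and \<open>\<Xi> 0 = 0\<close>, biconjugation and
  monotone convergence give the energy.
\<close>

subsection \<open>Functions of class $C^1$\<close>

text \<open>The constraint reveals a competitor only through its pairings with
  \<open>grad_z \<phi>\<close> for \<phi> of class C^1, so the field paired with it should be C^1 in
  x, compactly supported in x and independent of z. An optimal slope for f (x, u x) at grad u x need
  not exist, let alone depend on x in a C^1 way. Hence the slopes are frozen to countably many
  constant matrices, and only scalar weights vary with x. The second component is paired with the
  known graph measure instead, so a merely continuous conjugate is good enough there. Compact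
  support forces the weights to lose mass; the lost mass in effect sits on the slope 0, where the
  conjugate is nonpositive.

  A second obstacle is the boundary: u is C^1 inside \<Omega> only, and its gradient may be
  unbounded. Integrability of the gradient is extracted from the finite energy by the Fenchel
  inequality in the direction of the gradient itself, with the conjugate bounded on bounded sets. It
  makes \<open>E\<close> a finite measure and every \<open>h n\<close> integrable.\<close>

lemma C1_on_continuous_on: "C1_on g S \<Longrightarrow> continuous_on S g"
  unfolding C1_on_def
  by (metis continuous_at_imp_continuous_on has_derivative_continuous)

lemma C1_on_frechet_derivative:
  assumes "C1_on g S"
  obtains g' where "continuous_on S g'"
    and "\<And>x. x \<in> S \<Longrightarrow> (g has_derivative blinfun_apply (g' x)) (at x)"
    and "\<And>x. x \<in> S \<Longrightarrow> frechet_derivative g (at x) = blinfun_apply (g' x)"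
  using assms unfolding C1_on_def by (metis frechet_derivative_at)

lemma C1_on_subset: "C1_on g T \<Longrightarrow> S \<subseteq> T \<Longrightarrow> C1_on g S"
  unfolding C1_on_def by (meson continuous_on_subset subsetD)

lemma C1_on_bounded_linear:
  assumes "bounded_linear g"
  shows "C1_on g S"
  unfolding C1_on_def
  using assms
  by (intro exI[of _ "\<lambda>_. Blinfun g"])
    (auto simp: bounded_linear_Blinfun_apply intro!: bounded_linear_imp_has_derivative)

lemma C1_on_const: "C1_on (\<lambda>_. c) S"
  unfolding C1_on_def by (intro exI[of _ "\<lambda>_. 0"]) (auto simp: zero_blinfun.rep_eq)

lemma C1_on_compose:
  assumes "C1_on f S" "C1_on g T" "f ` S \<subseteq> T"
  shows "C1_on (\<lambda>x. g (f x)) S"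
proof -
  obtain f' where f': "\<And>x. x \<in> S \<Longrightarrow> (f has_derivative blinfun_apply (f' x)) (at x)" "continuous_on S f'"
    using assms(1) unfolding C1_on_def by blast
  obtain g' where g': "\<And>x. x \<in> T \<Longrightarrow> (g has_derivative blinfun_apply (g' x)) (at x)" "continuous_on T g'"
    using assms(2) unfolding C1_on_def by blast
  have "((\<lambda>x. g (f x)) has_derivative blinfun_apply (g' (f x) o\<^sub>L f' x)) (at x)" if "x \<in> S" for x
    using has_derivative_compose[OF f'(1)[OF that] g'(1)[of "f x"]] that assms(3)
    by (auto simp: blinfun_compose.rep_eq comp_def)
  moreover have "continuous_on S (\<lambda>x. g' (f x) o\<^sub>L f' x)"
    using C1_on_continuous_on[OF assms(1)] assms(3) f'(2)
    by (intro bounded_bilinear.continuous_on[OF bounded_bilinear_blinfun_compose]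
        continuous_on_compose2[OF g'(2)]) auto
  ultimately show ?thesis
    unfolding C1_on_def by (intro exI[of _ "\<lambda>x. g' (f x) o\<^sub>L f' x"]) simp
qed

lemma C1_on_Pair:
  fixes f :: "'a::real_normed_vector \<Rightarrow> 'b::real_normed_vector"
    and g :: "'a \<Rightarrow> 'c::real_normed_vector"
  assumes "C1_on f S" "C1_on g S"
  shows "C1_on (\<lambda>x. (f x, g x)) S"
proof -
  obtain f' where f': "\<And>x. x \<in> S \<Longrightarrow> (f has_derivative blinfun_apply (f' x)) (at x)" "continuous_on S f'"
    using assms(1) unfolding C1_on_def by blast
  obtain g' where g': "\<And>x. x \<in> S \<Longrightarrow> (g has_derivative blinfun_apply (g' x)) (at x)" "continuous_on S g'"
    using assms(2) unfolding C1_on_def by blast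
  \<comment> \<open>With the two injections as bounded operators, the derivative of the pair is a
    sum of operator compositions, so its continuity in operator norm follows from that of
    \<open>f'\<close> and \<open>g'\<close>.\<close>
  define L :: "'b \<Rightarrow>\<^sub>L ('b \<times> 'c)" where "L = Blinfun (\<lambda>y. (y, 0))"
  define R :: "'c \<Rightarrow>\<^sub>L ('b \<times> 'c)" where "R = Blinfun (\<lambda>y. (0, y))"
  have LR: "blinfun_apply L y = (y, 0)" "blinfun_apply R z = (0, z)" for y z
    unfolding L_def R_def
    by (auto simp: bounded_linear_Blinfun_apply bounded_linear_Pair bounded_linear_ident bounded_linear_zero)
  have "((\<lambda>x. (f x, g x)) has_derivative blinfun_apply ((L o\<^sub>L f' x) + (R o\<^sub>L g' x))) (at x)"
    if "x \<in> S" for x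
  proof -
    have "blinfun_apply ((L o\<^sub>L f' x) + (R o\<^sub>L g' x)) = (\<lambda>h. (f' x h, g' x h))"
      by (rule ext) (simp add: blinfun.bilinear_simps LR)
    then show ?thesis
      using has_derivative_Pair[OF f'(1)[OF that] g'(1)[OF that]] by simp
  qed
  moreover have "continuous_on S (\<lambda>x. (L o\<^sub>L f' x) + (R o\<^sub>L g' x))"
    by (intro continuous_on_add continuous_on_const f'(2) g'(2)
        bounded_bilinear.continuous_on[OF bounded_bilinear_blinfun_compose])
  ultimately show ?thesis
    unfolding C1_on_def by (intro exI[of _ "\<lambda>x. (L o\<^sub>L f' x) + (R o\<^sub>L g' x)"]) simp
qed

lemma C1_on_add:
  assumes "C1_on f S" "C1_on g S"
  shows "C1_on (\<lambda>x. f x + g x) S"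
  using C1_on_compose[OF C1_on_Pair[OF assms] C1_on_bounded_linear[of "\<lambda>p. fst p + snd p" UNIV]]
  by (simp add: bounded_linear_add bounded_linear_fst bounded_linear_snd)

lemma C1_on_sum: "(\<And>i. i \<in> I \<Longrightarrow> C1_on (f i) S) \<Longrightarrow> C1_on (\<lambda>x. \<Sum>i\<in>I. f i x) S"
  by (induction I rule: infinite_finite_induct) (auto intro: C1_on_const C1_on_add)

text \<open>The chain rule reduces this to the one map
  \<open>\<lambda>p. fst p *\<^sub>R snd p\<close>, whose derivative \<open>h p\<close> is linear in
  p and therefore continuous.\<close>

lemma C1_on_scaleR:
  fixes f :: "'a::real_normed_vector \<Rightarrow> real" and g :: "'a \<Rightarrow> 'b::real_normed_vector"
  assumes "C1_on f S" "C1_on g S"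
  shows "C1_on (\<lambda>x. f x *\<^sub>R g x) S"
proof -
  define h :: "real \<times> 'b \<Rightarrow> (real \<times> 'b) \<Rightarrow>\<^sub>L 'b"
    where "h p = (blinfun_scaleR_left (snd p) o\<^sub>L Blinfun fst) + fst p *\<^sub>R Blinfun snd" for p
  have h: "blinfun_apply (h p) = (\<lambda>q. fst q *\<^sub>R snd p + fst p *\<^sub>R snd q)" for p
    by (rule ext) (simp add: h_def blinfun.bilinear_simps bounded_linear_Blinfun_apply
        bounded_linear_fst bounded_linear_snd)
  have "((\<lambda>p. fst p *\<^sub>R snd p) has_derivative blinfun_apply (h x)) (at x)" for x
    unfolding h by (auto intro!: derivative_eq_intros)
  moreover have "continuous_on UNIV h"
    unfolding h_def by (intro continuous_intros)
  ultimately have "C1_on (\<lambda>p :: real \<times> 'b. fst p *\<^sub>R snd p) UNIV"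
    unfolding C1_on_def by (intro exI[of _ h]) simp
  from C1_on_compose[OF C1_on_Pair[OF assms] this] show ?thesis
    by simp
qed

lemma C1_on_diff:
  assumes "C1_on f S" "C1_on g S"
  shows "C1_on (\<lambda>x. f x - g x) S"
  using C1_on_add[OF assms(1) C1_on_scaleR[OF C1_on_const[of "-1"] assms(2)]] by simp

lemma C1_on_real_polynomial_function:
  "real_polynomial_function q \<Longrightarrow> C1_on q S"
proof (induction rule: real_polynomial_function.induct)
  case (mult f g)
  then show ?case
    using C1_on_scaleR[of f S g] by simp
qed (auto intro: C1_on_bounded_linear C1_on_const C1_on_add)

text \<open>Squaring removes the kink of the positive part at 0. In each of the four sign cases the
  remainder of the linear approximation is at most (y - x)^2, so after division by |y - x| it still
  tends to 0.\<close>

lemma C1_on_pos_part_square: "C1_on (\<lambda>y::real. (max 0 y)\<^sup>2) UNIV"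
  unfolding C1_on_def
proof (intro exI[of _ "\<lambda>y. blinfun_scaleR_left (2 * max 0 y)"] conjI ballI)
  fix x :: real
  have *: "\<bar>(max 0 y)\<^sup>2 - (max 0 x)\<^sup>2 - (y - x) * (2 * max 0 x)\<bar> \<le> (y - x)\<^sup>2" for y
  proof -
    have sq: "(y - x)\<^sup>2 = y * y - 2 * (x * y) + x * x"
      by (simp add: power2_eq_square algebra_simps)
    consider "x \<ge> 0" "y \<ge> 0" | "x \<ge> 0" "y < 0" | "x < 0" "y \<ge> 0" | "x < 0" "y < 0"
      by linarith
    then show ?thesis
    proof cases
      case 1
      then have "(max 0 y)\<^sup>2 - (max 0 x)\<^sup>2 - (y - x) * (2 * max 0 x) = y * y - 2 * (x * y) + x * x"
        using 1 by (simp add: max_def power2_eq_square algebra_simps)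
      then show ?thesis
        using sq zero_le_power2[of "y - x"] zero_le_square[of x] zero_le_square[of y] by linarith
    next
      case 2
      then have "x * y \<le> 0" by (simp add: mult_le_0_iff)
      moreover have "(max 0 y)\<^sup>2 - (max 0 x)\<^sup>2 - (y - x) * (2 * max 0 x) = x * x - 2 * (x * y)"
        using 2 by (simp add: max_def power2_eq_square algebra_simps)
      ultimately show ?thesis
        using sq zero_le_power2[of "y - x"] zero_le_square[of x] zero_le_square[of y] by linarith
    next
      case 3
      then have "x * y \<le> 0" by (simp add: mult_le_0_iff)
      moreover have "(max 0 y)\<^sup>2 - (max 0 x)\<^sup>2 - (y - x) * (2 * max 0 x) = y * y"
        using 3 by (simp add: max_def power2_eq_square algebra_simps)
      ultimately show ?thesis
        using sq zero_le_power2[of "y - x"] zero_le_square[of x] zero_le_square[of y] by linarith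
    next
      case 4
      then have "(max 0 y)\<^sup>2 - (max 0 x)\<^sup>2 - (y - x) * (2 * max 0 x) = 0"
        using 4 by (simp add: max_def power2_eq_square algebra_simps)
      then show ?thesis
        using sq zero_le_power2[of "y - x"] zero_le_square[of x] zero_le_square[of y] by linarith
    qed
  qed
  show "((\<lambda>y. (max 0 y)\<^sup>2) has_derivative blinfun_apply (blinfun_scaleR_left (2 * max 0 x))) (at x)"
  proof (rule has_derivativeI_sandwich[of 1])
    show "bounded_linear (blinfun_apply (blinfun_scaleR_left (2 * max 0 x)))"
      by (rule blinfun.bounded_linear_right)
    show "norm ((max 0 y)\<^sup>2 - (max 0 x)\<^sup>2 - blinfun_apply (blinfun_scaleR_left (2 * max 0 x)) (y - x)) / norm (y - x)
        \<le> \<bar>y - x\<bar>" if "y \<noteq> x" for y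
      using *[of y] that by (simp add: divide_simps power2_eq_square)
    show "((\<lambda>y. \<bar>y - x\<bar>) \<longlongrightarrow> 0) (at x)"
      by (auto intro!: tendsto_eq_intros)
  qed simp
  show "continuous_on UNIV (\<lambda>y::real. blinfun_scaleR_left (2 * max 0 y))"
    by (intro continuous_intros)
qed

text \<open>If \<open>q\<close> is a polynomial with \<open>sqrt c - 2 * \<delta> \<le> q \<le> sqrt c\<close>, then \<open>v = (max 0 q)\<^sup>2\<close> lies
  between \<open>c - 4 * \<delta>\<close> and \<open>c\<close>; in particular it vanishes wherever \<open>c\<close> does, so no smooth cut-off
  is needed.\<close>

lemma C1_approximation_from_below:
  fixes c :: "'a::euclidean_space \<Rightarrow> real"
  assumes "bounded \<Omega>" and c: "continuous_on UNIV c" "\<And>x. 0 \<le> c x" "\<And>x. c x \<le> 1" and "0 < \<epsilon>"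
  obtains v where "C1_on v \<Omega>" "\<And>x. 0 \<le> v x" "\<And>x. x \<in> \<Omega> \<Longrightarrow> v x \<le> c x" "\<And>x. x \<in> \<Omega> \<Longrightarrow> c x - \<epsilon> \<le> v x"
proof -
  define \<delta> where "\<delta> = \<epsilon> / 4"
  have "\<delta> > 0" using assms(5) by (simp add: \<delta>_def)
  \<comment> \<open>Aiming at sqrt c - \<delta> with error \<delta> keeps q below sqrt c. The
    closure supplies the compact set for Stone-Weierstrass.\<close>
  have "compact (closure \<Omega>)" "continuous_on (closure \<Omega>) (\<lambda>x. sqrt (c x) - \<delta>)"
    using assms(1) by (auto simp: compact_closure intro!: continuous_intros continuous_on_subset[OF c(1)])
  then obtain q where q: "real_polynomial_function q"
      "\<And>x. x \<in> closure \<Omega> \<Longrightarrow> \<bar>sqrt (c x) - \<delta> - q x\<bar> < \<delta>"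
    using \<open>\<delta> > 0\<close> by (rule Stone_Weierstrass_real_polynomial_function) (rule that)
  show ?thesis
  proof (rule that[of "\<lambda>x. (max 0 (q x))\<^sup>2"])
    show "C1_on (\<lambda>x. (max 0 (q x))\<^sup>2) \<Omega>"
      using C1_on_compose[OF C1_on_real_polynomial_function[OF q(1)] C1_on_pos_part_square] by simp
    fix x assume "x \<in> \<Omega>"
    then have "x \<in> closure \<Omega>"
      using closure_subset by blast
    define s where "s = sqrt (c x)"
    have s: "0 \<le> s" "s \<le> 1" "c x = s\<^sup>2"
      using c(2,3)[of x] by (auto simp: s_def)
    have b: "q x \<le> s" "s - 2 * \<delta> \<le> q x"
      using q(2)[OF \<open>x \<in> closure \<Omega>\<close>] by (auto simp: s_def)
    show "(max 0 (q x))\<^sup>2 \<le> c x"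
      unfolding s(3) using b s by (intro power_mono) auto
    have "s\<^sup>2 - \<epsilon> \<le> (max 0 (q x))\<^sup>2"
    proof (cases "s \<le> 2 * \<delta>")
      case True
      have "s\<^sup>2 \<le> s" using s by (simp add: power2_eq_square mult_left_le)
      with True \<open>\<delta> > 0\<close> have "s\<^sup>2 - \<epsilon> \<le> 0" by (simp add: \<delta>_def)
      then show ?thesis by (smt (verit) zero_le_power2)
    next
      case False
      \<comment> \<open>Now (s - 2 \<delta>)^2 >= s^2 - 4 s \<delta> >= s^2 - \<epsilon>, because s
        <= 1; this explains \<delta> = \<epsilon> / 4.\<close>
      have "s * \<delta> \<le> \<delta>" using s \<open>\<delta> > 0\<close> by simp
      then have "s\<^sup>2 - \<epsilon> \<le> (s - 2 * \<delta>)\<^sup>2"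
        using zero_le_power2[of "\<delta>"] assms(5)
        by (simp add: power2_eq_square algebra_simps \<delta>_def add_increasing2)
      also have "\<dots> \<le> (max 0 (q x))\<^sup>2"
        using False b by (intro power_mono) auto
      finally show ?thesis .
    qed
    then show "c x - \<epsilon> \<le> (max 0 (q x))\<^sup>2"
      by (simp add: s(3))
  qed simp
qed

subsection \<open>Vector measures with a density\<close>

lemma pos_variation_cong:
  assumes "\<And>A. A \<in> sets (restrict_space borel S) \<Longrightarrow> \<nu> A = \<nu>' A"
  shows "pos_variation S \<nu> = pos_variation S \<nu>'"
proof -
  have "(SUP B\<in>{B \<in> sets (restrict_space borel S). B \<subseteq> A}. ennreal (\<nu> B)) =
      (SUP B\<in>{B \<in> sets (restrict_space borel S). B \<subseteq> A}. ennreal (\<nu>' B))" for A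
    using assms by (intro SUP_cong) auto
  then show ?thesis
    by (simp add: pos_variation_def)
qed

text \<open>Agreement on Borel sets is the right hypothesis: taking a component of a set integral
  commutes with integration on measurable sets, and nothing is claimed for the others.\<close>

lemma signed_integral_cong:
  assumes "\<And>t. t \<in> S \<Longrightarrow> h t = h' t"
    and "\<And>A. A \<in> sets (restrict_space borel S) \<Longrightarrow> \<nu> A = \<nu>' A"
  shows "signed_integral S h \<nu> = signed_integral S h' \<nu>'"
proof -
  have "space (pos_variation S \<kappa>) = S" for \<kappa>
    by (simp add: pos_variation_def space_measure_of_conv)
  moreover have "pos_variation S \<nu> = pos_variation S \<nu>'"
    "pos_variation S (\<lambda>A. - \<nu> A) = pos_variation S (\<lambda>A. - \<nu>' A)"
    using assms(2) by (auto intro!: pos_variation_cong)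
  ultimately show ?thesis
    unfolding signed_integral_def
    by (intro arg_cong2[where f = minus] Bochner_Integration.integral_cong) (auto simp: assms(1))
qed

lemma pairing_integral_cong:
  assumes "\<And>t. t \<in> S \<Longrightarrow> \<phi> t = \<phi>' t"
  shows "pairing_integral S \<phi> \<nu> = pairing_integral S \<phi>' \<nu>"
  unfolding pairing_integral_def
  by (intro sum.cong signed_integral_cong) (auto simp: assms)

text \<open>Countable additivity is finite additivity followed by continuity along the increasing
  unions of the first n sets.\<close>

lemma set_integral_vector_measures:
  fixes G :: "'a::topological_space \<Rightarrow> 'b::euclidean_space"
  assumes "sets M = sets (restrict_space borel S)" "integrable M G"
  shows "(\<lambda>A. LINT t:A|M. G t) \<in> vector_measures S"
proof -
  have "(\<lambda>n. LINT t:A n|M. G t) sums (LINT t:(\<Union>n. A n)|M. G t)"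
    if "range A \<subseteq> sets M" "disjoint_family A" for A :: "nat \<Rightarrow> 'a set"
  proof -
    have A: "A n \<in> sets M" for n
      using that(1) by auto
    have int: "set_integrable M B G" if "B \<in> sets M" for B
      unfolding set_integrable_def using integrable_mult_indicator[OF that assms(2)] .
    have "(\<lambda>n. LINT t:(\<Union>i<n. A i)|M. G t) \<longlonglongrightarrow> (LINT t:(\<Union>n. \<Union>i<n. A i)|M. G t)"
      by (intro set_integral_cont_up int sets.finite_UN sets.countable_nat_UN)
        (auto simp: incseq_def A intro!: sets.finite_UN less_le_trans)
    moreover have "(\<Union>n. \<Union>i<n. A i) = (\<Union>n. A n)"
      by auto
    moreover have "(LINT t:(\<Union>i<n. A i)|M. G t) = (\<Sum>i<n. LINT t:A i|M. G t)" for n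
      using that(2) A by (intro set_integral_finite_Union int)
        (auto simp: disjoint_family_on_def)
    ultimately show ?thesis
      by (simp add: sums_def)
  qed
  then show ?thesis
    by (simp add: vector_measures_def assms(1)[symmetric] set_lebesgue_integral_def)
qed

text \<open>Made for integrands of unknown sign: \<open>ennreal\<close> discards the negative part
  on the right, which can only enlarge the integral.\<close>

lemma integral_le_nn_integral:
  assumes "integrable M f"
  shows "ennreal (\<integral>x. f x \<partial>M) \<le> (\<integral>\<^sup>+x. ennreal (f x) \<partial>M)"
proof -
  have "ennreal (\<integral>x. f x \<partial>M) \<le> ennreal (\<integral>x. max 0 (f x) \<partial>M)"
    using assms by (intro ennreal_leI integral_mono) auto
  also have "\<dots> = (\<integral>\<^sup>+x. ennreal (max 0 (f x)) \<partial>M)"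
    using assms by (intro nn_integral_eq_integral[symmetric]) auto
  finally show ?thesis
    by (simp add: ennreal_max_0)
qed

text \<open>The supremum over subsets of A is attained on the Hahn set, the part of A where G > 0.
  Since \<open>ennreal\<close> truncates, the density \<open>ennreal (G t)\<close> is already the
  positive part of G.\<close>

lemma pos_variation_set_integral:
  fixes G :: "'a::topological_space \<Rightarrow> real"
  assumes sets: "sets M = sets (restrict_space borel S)" and G: "integrable M G"
  shows "pos_variation S (\<lambda>A. LINT t:A|M. G t) = density M (\<lambda>t. ennreal (G t))"
proof -
  let ?D = "density M (\<lambda>t. ennreal (G t))"
  have [measurable]: "G \<in> borel_measurable M"
    using G by simp
  have sp: "space M = S"
    using sets_eq_imp_space_eq[OF sets] by (simp add: space_restrict_space)
  have int: "integrable M (\<lambda>t. indicator B t * G t)" if "B \<in> sets M" for B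
    using integrable_mult_indicator[OF that G] by simp
  have "(SUP B\<in>{B \<in> sets M. B \<subseteq> A}. ennreal (LINT t:B|M. G t)) = emeasure ?D A"
    if A[measurable]: "A \<in> sets M" for A
  proof (rule antisym)
    show "(SUP B\<in>{B \<in> sets M. B \<subseteq> A}. ennreal (LINT t:B|M. G t)) \<le> emeasure ?D A"
    proof (rule SUP_least)
      fix B assume B: "B \<in> {B \<in> sets M. B \<subseteq> A}"
      have "ennreal (LINT t:B|M. G t) \<le> (\<integral>\<^sup>+t. ennreal (indicator B t * G t) \<partial>M)"
        using integral_le_nn_integral[OF int[of B]] B by (simp add: set_lebesgue_integral_def)
      also have "\<dots> \<le> (\<integral>\<^sup>+t. ennreal (G t) * indicator A t \<partial>M)"
        using B by (intro nn_integral_mono) (auto split: split_indicator)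
      also have "\<dots> = emeasure ?D A"
        by (simp add: emeasure_density)
      finally show "ennreal (LINT t:B|M. G t) \<le> emeasure ?D A" .
    qed
    define B where "B = {t \<in> space M. t \<in> A \<and> 0 < G t}"
    have B: "B \<in> sets M"
      unfolding B_def by measurable
    have "emeasure ?D A = (\<integral>\<^sup>+t. ennreal (indicator B t * G t) \<partial>M)"
      by (subst emeasure_density)
        (auto intro!: nn_integral_cong simp: B_def ennreal_neg split: split_indicator)
    also have "\<dots> = ennreal (LINT t:B|M. G t)"
      using nn_integral_eq_integral[OF int[OF B]]
      by (simp add: set_lebesgue_integral_def) (auto simp: B_def indicator_def)
    finally show "emeasure ?D A \<le> (SUP B\<in>{B \<in> sets M. B \<subseteq> A}. ennreal (LINT t:B|M. G t))"
      using B by (intro SUP_upper2[of B]) (auto simp: B_def)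
  qed
  then have "measure_of S (sets M) (\<lambda>A. SUP B\<in>{B \<in> sets M. B \<subseteq> A}. ennreal (LINT t:B|M. G t))
      = measure_of (space ?D) (sets ?D) (emeasure ?D)"
    unfolding space_density sets_density sp[symmetric]
    by (intro measure_of_eq) (auto simp: sets.sigma_sets_eq sets.space_closed)
  then show ?thesis
    unfolding pos_variation_def sets[symmetric] by (simp only: measure_of_of_measure)
qed

lemma signed_integral_set_integral:
  fixes G h :: "'a::topological_space \<Rightarrow> real"
  assumes "sets M = sets (restrict_space borel S)" and G: "integrable M G"
    and h[measurable]: "h \<in> borel_measurable M" and hG: "integrable M (\<lambda>t. h t * G t)"
  shows "signed_integral S h (\<lambda>A. LINT t:A|M. G t) = (\<integral>t. h t * G t \<partial>M)"
proof -
  have [measurable]: "G \<in> borel_measurable M"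
    using G by simp
  \<comment> \<open>Both parts of G are dominated by |G|, so integrability of h G passes to the two
    integrals, which may then be subtracted.\<close>
  have bd: "norm (max 0 (G t) * h t) \<le> norm (h t * G t)" "norm (max 0 (- G t) * h t) \<le> norm (h t * G t)" for t
    unfolding norm_mult mult.commute[of "norm (h t)"] by (intro mult_right_mono; simp)+
  have "(\<lambda>A. - (LINT t:A|M. G t)) = (\<lambda>A. LINT t:A|M. - G t)"
    by (simp add: set_lebesgue_integral_def)
  then have "pos_variation S (\<lambda>A. - (LINT t:A|M. G t)) = density M (\<lambda>t. ennreal (- G t))"
    using pos_variation_set_integral[OF assms(1), of "\<lambda>t. - G t"] G by simp
  moreover have "integral\<^sup>L (density M (\<lambda>t. ennreal (g t))) h = (\<integral>t. max 0 (g t) * h t \<partial>M)"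
    if [measurable]: "g \<in> borel_measurable M" for g
    using integral_density[of h M "\<lambda>t. max 0 (g t)"] by (simp add: ennreal_max_0)
  ultimately have "signed_integral S h (\<lambda>A. LINT t:A|M. G t) =
      (\<integral>t. max 0 (G t) * h t \<partial>M) - (\<integral>t. max 0 (- G t) * h t \<partial>M)"
    by (simp add: signed_integral_def pos_variation_set_integral[OF assms(1) G])
  also have "\<dots> = (\<integral>t. max 0 (G t) * h t - max 0 (- G t) * h t \<partial>M)"
    using bd by (intro Bochner_Integration.integral_diff[symmetric]
        Bochner_Integration.integrable_bound[OF hG]) auto
  also have "\<dots> = (\<integral>t. h t * G t \<partial>M)"
    by (intro Bochner_Integration.integral_cong) (auto simp: max_def mult.commute)
  finally show ?thesis .
qed

lemma pairing_integral_set_integral: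
  fixes G \<phi> :: "'a::topological_space \<Rightarrow> 'b::euclidean_space"
  assumes "sets M = sets (restrict_space borel S)" and G: "integrable M G"
    and \<phi>[measurable]: "\<phi> \<in> borel_measurable M" and B: "\<And>t. t \<in> S \<Longrightarrow> norm (\<phi> t) \<le> B"
  shows "integrable M (\<lambda>t. \<phi> t \<bullet> G t)"
    and "pairing_integral S \<phi> (\<lambda>A. LINT t:A|M. G t) = (\<integral>t. \<phi> t \<bullet> G t \<partial>M)"
proof -
  have [measurable]: "G \<in> borel_measurable M"
    using G by simp
  have sp: "space M = S"
    using sets_eq_imp_space_eq[OF assms(1)] by (simp add: space_restrict_space)
  have int: "integrable M (\<lambda>t. (\<phi> t \<bullet> b) * (G t \<bullet> b))" if "b \<in> Basis" for b
  proof (rule Bochner_Integration.integrable_bound)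
    show "integrable M (\<lambda>t. B * norm (G t))"
      using G by simp
    show "AE t in M. norm ((\<phi> t \<bullet> b) * (G t \<bullet> b)) \<le> norm (B * norm (G t))"
    proof (rule AE_I2)
      fix t assume "t \<in> space M"
      then have "norm (\<phi> t) \<le> B"
        using B sp by simp
      then have "\<bar>\<phi> t \<bullet> b\<bar> \<le> B" "\<bar>G t \<bullet> b\<bar> \<le> norm (G t)"
        using Basis_le_norm[OF that, of "\<phi> t"] Basis_le_norm[OF that, of "G t"] by auto
      then show "norm ((\<phi> t \<bullet> b) * (G t \<bullet> b)) \<le> norm (B * norm (G t))"
        by (auto simp: abs_mult intro!: mult_mono)
    qed
  qed simp
  have sum: "(\<Sum>b\<in>Basis. (\<phi> t \<bullet> b) * (G t \<bullet> b)) = \<phi> t \<bullet> G t" for t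
    by (rule euclidean_inner[symmetric])
  show "integrable M (\<lambda>t. \<phi> t \<bullet> G t)"
    using Bochner_Integration.integrable_sum[of Basis M "\<lambda>b t. (\<phi> t \<bullet> b) * (G t \<bullet> b)", OF int] unfolding sum .
  have "signed_integral S (\<lambda>t. \<phi> t \<bullet> b) (\<lambda>A. (LINT t:A|M. G t) \<bullet> b) = (\<integral>t. (\<phi> t \<bullet> b) * (G t \<bullet> b) \<partial>M)"
    if "b \<in> Basis" for b
  proof -
    have "(LINT t:A|M. G t) \<bullet> b = (LINT t:A|M. G t \<bullet> b)" if "A \<in> sets M" for A
      using integral_inner_left[OF integrable_mult_indicator[OF that G], of b]
      by (simp add: set_lebesgue_integral_def)
    then have "signed_integral S (\<lambda>t. \<phi> t \<bullet> b) (\<lambda>A. (LINT t:A|M. G t) \<bullet> b) =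
        signed_integral S (\<lambda>t. \<phi> t \<bullet> b) (\<lambda>A. LINT t:A|M. G t \<bullet> b)"
      by (intro signed_integral_cong) (auto simp: assms(1))
    also have "\<dots> = (\<integral>t. (\<phi> t \<bullet> b) * (G t \<bullet> b) \<partial>M)"
      using G int[OF that] by (intro signed_integral_set_integral assms(1)) auto
    finally show ?thesis .
  qed
  then have "pairing_integral S \<phi> (\<lambda>A. LINT t:A|M. G t) = (\<Sum>b\<in>Basis. \<integral>t. (\<phi> t \<bullet> b) * (G t \<bullet> b) \<partial>M)"
    by (simp add: pairing_integral_def)
  also have "\<dots> = (\<integral>t. \<phi> t \<bullet> G t \<partial>M)"
    using Bochner_Integration.integral_sum[of Basis M "\<lambda>b t. (\<phi> t \<bullet> b) * (G t \<bullet> b)", OF int]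
    unfolding sum by simp
  finally show "pairing_integral S \<phi> (\<lambda>A. LINT t:A|M. G t) = (\<integral>t. \<phi> t \<bullet> G t \<partial>M)" .
qed

subsection \<open>Integrals of derivatives\<close>

text \<open>By translation invariance the integral of a difference quotient vanishes; the limit is
  taken under the integral by dominated convergence.\<close>

lemma integral_directional_derivative_compact_support:
  fixes \<psi> :: "'a::euclidean_space \<Rightarrow> real"
  assumes "open \<Omega>" "C1_on \<psi> \<Omega>" "compact K" "K \<subseteq> \<Omega>" and supp: "\<And>x. x \<in> \<Omega> - K \<Longrightarrow> \<psi> x = 0"
  shows "integrable (restrict_space lborel \<Omega>) (\<lambda>x. frechet_derivative \<psi> (at x) e)"
    and "(\<integral>x. frechet_derivative \<psi> (at x) e \<partial>restrict_space lborel \<Omega>) = 0"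
proof -
  obtain g' where g': "continuous_on \<Omega> g'" "\<And>x. x \<in> \<Omega> \<Longrightarrow> (\<psi> has_derivative blinfun_apply (g' x)) (at x)"
      "\<And>x. x \<in> \<Omega> \<Longrightarrow> frechet_derivative \<psi> (at x) = blinfun_apply (g' x)"
    using C1_on_frechet_derivative[OF assms(2)] by metis
  \<comment> \<open>Translations leave \<Omega>, so the function is extended by zero to the whole
    space. The extension is differentiable everywhere because \<Omega> and the complement of K are
    open and cover the space.\<close>
  define \<Psi> where "\<Psi> x = (if x \<in> \<Omega> then \<psi> x else 0)" for x
  define D where "D x = (if x \<in> \<Omega> then g' x else 0)" for x
  have "open (- K)"
    using assms(3) by (simp add: compact_imp_closed open_Compl)
  have \<Psi>0: "\<Psi> x = 0" if "x \<notin> K" for x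
    using supp that by (auto simp: \<Psi>_def)
  have der0: "(\<Psi> has_derivative (\<lambda>_. 0)) (at x)" if "x \<notin> K" for x
    using has_derivative_transform_within_open[OF has_derivative_const \<open>open (- K)\<close>, of x 0 \<Psi>]
      that \<Psi>0 by auto
  have der: "(\<Psi> has_derivative blinfun_apply (D x)) (at x)" for x
  proof (cases "x \<in> \<Omega>")
    case True
    then show ?thesis
      using has_derivative_transform_within_open[OF g'(2)[OF True] assms(1) True, of \<Psi>]
      by (auto simp: \<Psi>_def D_def)
  next
    case False
    then have "x \<notin> K" using assms(4) by auto
    with der0[of x] False show ?thesis
      by (simp add: D_def zero_blinfun.rep_eq)
  qed
  \<comment> \<open>Uniqueness of derivatives shows that D vanishes off K, also at points of
    \<Omega>; compactness of K then bounds D and makes \<Psi> Lipschitz.\<close>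
  have D0: "D x = 0" if "x \<notin> K" for x
    using has_derivative_unique[OF der[of x] der0[OF that]]
    by (intro blinfun_eqI) simp
  have "bounded (g' ` K)"
    using assms(3,4) g'(1) by (intro compact_imp_bounded compact_continuous_image) (auto intro: continuous_on_subset)
  then obtain B where B: "B > 0" "\<And>x. x \<in> K \<Longrightarrow> norm (g' x) \<le> B"
    by (auto simp: bounded_pos)
  have DB: "norm (D x) \<le> B" for x
    using D0[of x] B assms(4) by (cases "x \<in> K") (auto simp: D_def)
  have lip: "norm (\<Psi> y - \<Psi> x) \<le> B * norm (y - x)" for x y
    using DB by (intro differentiable_bound[of UNIV \<Psi> "\<lambda>x. blinfun_apply (D x)"])
      (auto simp: norm_blinfun.rep_eq[symmetric] der)
  have cont: "continuous_on UNIV \<Psi>"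
    using der by (meson continuous_at_imp_continuous_on has_derivative_continuous)
  then have [measurable]: "\<Psi> \<in> borel_measurable borel"
    by (rule borel_measurable_continuous_onI)
  obtain R where R: "R > 0" "\<And>x. x \<in> K \<Longrightarrow> norm x \<le> R"
    using compact_imp_bounded[OF assms(3)] by (auto simp: bounded_pos)
  have "bounded (\<Psi> ` K)"
    using assms(3) cont by (intro compact_imp_bounded compact_continuous_image) (auto intro: continuous_on_subset)
  then obtain C where C: "C > 0" "\<And>x. x \<in> K \<Longrightarrow> norm (\<Psi> x) \<le> C"
    by (auto simp: bounded_pos)
  have int: "integrable lborel \<Psi>"
    using C \<Psi>0 compact_imp_closed[OF assms(3)] emeasure_bounded_finite[OF compact_imp_bounded[OF assms(3)]]
    by (intro integrableI_bounded_set[of K _ _ C]) auto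
  have shift: "integrable lborel (\<lambda>x. \<Psi> (c + x))" "(\<integral>x. \<Psi> (c + x) \<partial>lborel) = (\<integral>x. \<Psi> x \<partial>lborel)" for c
  proof -
    have "integrable (distr lborel borel ((+) c)) \<Psi> \<longleftrightarrow> integrable lborel (\<lambda>x. \<Psi> (c + x))"
      by (intro integrable_distr_eq) auto
    then show "integrable lborel (\<lambda>x. \<Psi> (c + x))"
      using int by (simp add: lborel_distr_plus)
    have "integral\<^sup>L (distr lborel borel ((+) c)) \<Psi> = (\<integral>x. \<Psi> (c + x) \<partial>lborel)"
      by (intro integral_distr) auto
    then show "(\<integral>x. \<Psi> (c + x) \<partial>lborel) = (\<integral>x. \<Psi> x \<partial>lborel)"
      by (simp add: lborel_distr_plus)
  qed
  define h :: "nat \<Rightarrow> real" where "h n = inverse (real (Suc n))" for n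
  have h: "h n > 0" "h n \<le> 1" for n
    by (auto simp: h_def field_simps)
  define s where "s n x = (\<Psi> (h n *\<^sub>R e + x) - \<Psi> x) / h n" for n x
  have s: "s n \<in> borel_measurable lborel" for n
    unfolding s_def by measurable
  have lim: "(\<lambda>n. s n x) \<longlonglongrightarrow> D x e" for x
  proof -
    have "((\<lambda>t::real. \<Psi> (x + t *\<^sub>R e)) has_derivative (\<lambda>t. D x (t *\<^sub>R e))) (at 0)"
      by (rule has_derivative_compose[where f = "\<lambda>t. x + t *\<^sub>R e" and g = \<Psi>])
        (auto intro!: derivative_eq_intros der)
    then have "((\<lambda>t::real. \<Psi> (x + t *\<^sub>R e)) has_field_derivative D x e) (at 0)"
      by (simp add: has_field_derivative_def blinfun.bilinear_simps mult_commute_abs)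
    then have "((\<lambda>t. (\<Psi> (x + t *\<^sub>R e) - \<Psi> x) / t) \<longlongrightarrow> D x e) (at 0)"
      by (simp add: DERIV_def)
    moreover have "h \<longlonglongrightarrow> 0"
      unfolding h_def[abs_def] by (rule LIMSEQ_inverse_real_of_nat)
    then have "filterlim h (at 0) sequentially"
      using h(1) by (auto simp: filterlim_at less_imp_neq[symmetric] intro!: always_eventually)
    ultimately show ?thesis
      unfolding s_def by (auto simp: add.commute dest: filterlim_compose)
  qed
  have "(\<integral>x. s n x \<partial>lborel) = 0" for n
    using shift[of "h n *\<^sub>R e"] int by (simp add: s_def)
  moreover have "(\<lambda>n. \<integral>x. s n x \<partial>lborel) \<longlonglongrightarrow> (\<integral>x. D x e \<partial>lborel)"
  \<comment> \<open>The Lipschitz bound controls each quotient by B |e|. Since the steps are at most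
    1, all quotients vanish outside the ball of radius R + |e|.\<close>
  proof (rule integral_dominated_convergence[where w = "\<lambda>x. B * norm e * indicator (cball 0 (R + norm e)) x"])
    show "AE x in lborel. (\<lambda>n. s n x) \<longlonglongrightarrow> D x e"
      using lim by simp
    show "s n \<in> borel_measurable lborel" for n
      by (rule s)
    show "(\<lambda>x. D x e) \<in> borel_measurable lborel"
      using s lim by (rule borel_measurable_LIMSEQ_metric)
    show "AE x in lborel. norm (s n x) \<le> B * norm e * indicator (cball 0 (R + norm e)) x" for n
    proof (rule AE_I2)
      fix x
      show "norm (s n x) \<le> B * norm e * indicator (cball 0 (R + norm e)) x"
      proof (cases "norm x \<le> R + norm e")
        case True
        have "\<bar>\<Psi> (h n *\<^sub>R e + x) - \<Psi> x\<bar> \<le> B * (h n * norm e)"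
          using lip[of "h n *\<^sub>R e + x" x] h(1)[of n] by simp
        then show ?thesis
          using True h(1)[of n] by (simp add: s_def field_simps abs_mult)
      next
        case False
        have "norm x \<le> norm (h n *\<^sub>R e + x) + h n * norm e"
          using norm_triangle_ineq4[of "h n *\<^sub>R e + x" "h n *\<^sub>R e"] h(1)[of n] by simp
        moreover have "h n * norm e \<le> norm e"
          using h(2)[of n] h(1)[of n] by (simp add: mult_left_le_one_le)
        ultimately have "\<not> norm x \<le> R" "\<not> norm (h n *\<^sub>R e + x) \<le> R"
          using False norm_ge_zero[of e] by linarith+
        then have "x \<notin> K" "h n *\<^sub>R e + x \<notin> K"
          using R(2) by blast+
        then show ?thesis
          by (simp add: s_def \<Psi>0 B(1) less_imp_le)
      qed
    qed
    show "integrable lborel (\<lambda>x. B * norm e * indicator (cball 0 (R + norm e)) x)"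
      using emeasure_bounded_finite[OF bounded_cball, of 0 "R + norm e"]
      by (intro integrable_mult_right integrable_real_indicator) auto
  qed
  ultimately have D_zero: "(\<integral>x. D x e \<partial>lborel) = 0"
    by (simp add: LIMSEQ_const_iff)
  have eq: "indicator \<Omega> x *\<^sub>R frechet_derivative \<psi> (at x) e = D x e" for x
    by (simp add: D_def g'(3) indicator_def)
  show "(\<integral>x. frechet_derivative \<psi> (at x) e \<partial>restrict_space lborel \<Omega>) = 0"
    using assms(1) by (subst integral_restrict_space) (simp_all add: eq D_zero del: real_scaleR_def)
  have "integrable lborel (\<lambda>x. D x e)"
  proof (rule integrableI_bounded_set[of K _ _ "B * norm e"])
    show "(\<lambda>x. D x e) \<in> borel_measurable lborel"
      using s lim by (rule borel_measurable_LIMSEQ_metric)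
    have "norm (D x e) \<le> B * norm e" for x
      using norm_blinfun[of "D x" e] mult_right_mono[OF DB[of x], of "norm e"] by simp
    then show "AE x in lborel. x \<in> K \<longrightarrow> norm (D x e) \<le> B * norm e"
      by simp
  qed (use D0 compact_imp_closed[OF assms(3)] emeasure_bounded_finite[OF compact_imp_bounded[OF assms(3)]]
      in auto)
  then show "integrable (restrict_space lborel \<Omega>) (\<lambda>x. frechet_derivative \<psi> (at x) e)"
    using assms(1) by (subst integrable_restrict_space) (simp_all add: eq del: real_scaleR_def)
qed

subsection \<open>Affine minorants and weights concentrating on a maximum\<close>

lemma lsc_on_openin_superlevel:
  assumes "lsc_on S g"
  shows "openin (top_of_set S) {x \<in> S. y < g x}"
proof (subst openin_subopen, intro ballI)
  fix x assume "x \<in> {x \<in> S. y < g x}"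
  then have x: "x \<in> S" "y < g x" by auto
  then have "\<forall>\<^sub>F x' in at x within S. y < g x'"
    using assms unfolding lsc_on_def le_Liminf_iff by blast
  then obtain T where T: "open T" "x \<in> T" "\<forall>x'\<in>T. x' \<noteq> x \<longrightarrow> x' \<in> S \<longrightarrow> y < g x'"
    unfolding eventually_at_topological by blast
  with x show "\<exists>T. openin (top_of_set S) T \<and> x \<in> T \<and> T \<subseteq> {x \<in> S. y < g x}"
    by (intro exI[of _ "S \<inter> T"]) (auto simp: openin_open_Int)
qed

text \<open>Separating \<open>(p0, \<alpha>)\<close> from the epigraph gives the minorant unless the hyperplane is
  vertical; since \<open>F \<ge> 0\<close>, a vertical hyperplane can be tilted.\<close>

lemma convex_lsc_affine_minorant:
  fixes F :: "'p::euclidean_space \<Rightarrow> ennreal"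
  assumes conv: "convex_ennreal F" and lsc: "\<And>y. open {p. y < F p}"
    and p1: "F p1 < top" and \<alpha>: "0 \<le> \<alpha>" "ennreal \<alpha> < F p0"
  obtains \<xi> where "\<And>q. ereal (\<alpha> + \<xi> \<bullet> (q - p0)) \<le> enn2ereal (F q)"
proof -
  \<comment> \<open>The condition 0 <= \<beta> is explicit because \<open>ennreal\<close> truncates:
    where F q = 0, negative heights would otherwise enter the epigraph.\<close>
  define C where "C = {(q, \<beta>). 0 \<le> \<beta> \<and> F q \<le> ennreal \<beta>}"
  have "convex C"
    unfolding convex_alt
  proof (intro ballI allI impI)
    fix a b and \<theta> :: real assume "a \<in> C" "b \<in> C" and \<theta>: "0 \<le> \<theta> \<and> \<theta> \<le> 1"
    then obtain p \<beta> q \<gamma> where ab: "a = (p, \<beta>)" "b = (q, \<gamma>)" "0 \<le> \<beta>" "0 \<le> \<gamma>"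
      "F p \<le> ennreal \<beta>" "F q \<le> ennreal \<gamma>"
      by (auto simp: C_def)
    have "F ((1 - \<theta>) *\<^sub>R p + \<theta> *\<^sub>R q) \<le> ennreal (1 - \<theta>) * F p + ennreal \<theta> * F q"
      using conv \<theta> by (auto simp: convex_ennreal_def)
    also have "\<dots> \<le> ennreal (1 - \<theta>) * ennreal \<beta> + ennreal \<theta> * ennreal \<gamma>"
      using ab by (intro add_mono mult_left_mono) auto
    also have "\<dots> = ennreal ((1 - \<theta>) * \<beta> + \<theta> * \<gamma>)"
      using ab \<theta> by (simp add: ennreal_mult'[symmetric] ennreal_plus[symmetric] del: ennreal_plus)
    finally show "(1 - \<theta>) *\<^sub>R a + \<theta> *\<^sub>R b \<in> C"
      using ab \<theta> by (simp add: C_def)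
  qed
  moreover have "closed C"
  proof -
    \<comment> \<open>A point below the graph stays below it with some room r, so the complement is
      a union of open boxes; lower semicontinuity enters through \<open>lsc\<close>.\<close>
    have "- C = (UNIV \<times> {..<0}) \<union> (\<Union>r\<in>{0..}. {p. ennreal r < F p} \<times> {..<r})"
    proof (intro equalityI subsetI)
      fix a assume a: "a \<in> - C"
      obtain q \<beta> where [simp]: "a = (q, \<beta>)" by (cases a)
      show "a \<in> (UNIV \<times> {..<0}) \<union> (\<Union>r\<in>{0..}. {p. ennreal r < F p} \<times> {..<r})"
      proof (cases "\<beta> < 0")
        case False
        then have "ennreal \<beta> < F q" using a by (auto simp: C_def)
        then obtain y where y: "ennreal \<beta> < y" "y < F q" using dense by blast
        then obtain r where r: "y = ennreal r" "0 \<le> r"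
          by (cases y) (auto simp: top.not_eq_extremum)
        then have "\<beta> < r" using y False by (simp add: ennreal_less_iff)
        then show ?thesis using r y by auto
      qed simp
    next
      fix a assume "a \<in> (UNIV \<times> {..<0}) \<union> (\<Union>r\<in>{0..}. {p. ennreal r < F p} \<times> {..<r})"
      then consider "snd a < 0" | r where "0 \<le> r" "ennreal r < F (fst a)" "snd a < r"
        by auto
      then show "a \<in> - C"
      proof cases
        case 2
        then have "ennreal (snd a) < F (fst a)"
          by (meson ennreal_leI le_less_trans less_imp_le)
        then show ?thesis by (auto simp: C_def)
      qed (auto simp: C_def)
    qed
    moreover have "open ((UNIV \<times> {..<0}) \<union> (\<Union>r\<in>{0..}. {p. ennreal r < F p} \<times> {..<r}))"
      by (intro open_Un open_UN ballI open_Times lsc) auto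
    ultimately show ?thesis
      by (simp add: closed_def)
  qed
  moreover have "(p0, \<alpha>) \<notin> C"
    using \<alpha> by (auto simp: C_def)
  ultimately obtain a b where ab: "a \<bullet> (p0, \<alpha>) < b" "\<And>x. x \<in> C \<Longrightarrow> a \<bullet> x > b"
    using separating_hyperplane_closed_point by metis
  obtain a1 a2 where a: "a = (a1, a2)" by (cases a)
  have ab1: "a1 \<bullet> p0 + a2 * \<alpha> < b"
    using ab(1) by (simp add: a)
  have ab2: "b < a1 \<bullet> q + a2 * \<beta>" if "0 \<le> \<beta>" "F q \<le> ennreal \<beta>" for q \<beta>
    using ab(2)[of "(q, \<beta>)"] that by (simp add: a C_def)
  have a2: "0 \<le> a2"
  proof (rule ccontr)
    assume neg: "\<not> 0 \<le> a2"
    obtain \<beta> where \<beta>: "F p1 = ennreal \<beta>" "0 \<le> \<beta>"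
      using p1 by (cases "F p1") auto
    \<comment> \<open>The epigraph contains every height above \<beta> over p1. With a2 < 0, the
      separating inequality fails from the height (b - a1 \<bullet> p1) / a2 upwards.\<close>
    define \<gamma> where "\<gamma> = max \<beta> ((b - a1 \<bullet> p1) / a2)"
    have "a2 * \<gamma> \<le> a2 * ((b - a1 \<bullet> p1) / a2)"
      using neg by (intro mult_left_mono_neg) (auto simp: \<gamma>_def)
    also have "\<dots> = b - a1 \<bullet> p1"
      using neg by simp
    finally have "a2 * \<gamma> \<le> b - a1 \<bullet> p1" .
    moreover have "0 \<le> \<gamma>" "F p1 \<le> ennreal \<gamma>"
      using \<beta> by (auto simp: \<gamma>_def intro: ennreal_leI)
    ultimately show False
      using ab2[of \<gamma> p1] by simp
  qed
  show ?thesis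
  proof (cases "a2 = 0")
    case True
    \<comment> \<open>Here e is the gap by which the vertical hyperplane separates p0 from the
      domain of F. A descent at rate \<alpha> / e along a1 starts from \<alpha> at p0 and is
      nonpositive wherever F is finite.\<close>
    define e where "e = b - a1 \<bullet> p0"
    have e: "e > 0" using ab1 True by (simp add: e_def)
    show ?thesis
    proof (rule that[of "- (\<alpha> / e) *\<^sub>R a1"])
      fix q
      show "ereal (\<alpha> + (- (\<alpha> / e) *\<^sub>R a1) \<bullet> (q - p0)) \<le> enn2ereal (F q)"
      proof (cases "F q")
        case (real \<beta>)
        then have "e \<le> a1 \<bullet> q - a1 \<bullet> p0"
          using ab2[of \<beta> q] True by (simp add: e_def)
        then have "\<alpha> / e * e \<le> \<alpha> / e * (a1 \<bullet> q - a1 \<bullet> p0)"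
          using \<alpha>(1) e by (intro mult_left_mono) auto
        moreover have "\<alpha> / e * e = \<alpha>"
          using e by simp
        moreover have "\<alpha> + (- (\<alpha> / e) *\<^sub>R a1) \<bullet> (q - p0) = \<alpha> - \<alpha> / e * (a1 \<bullet> q - a1 \<bullet> p0)"
          unfolding inner_scaleR_left inner_diff_right by (simp add: algebra_simps)
        ultimately have "\<alpha> + (- (\<alpha> / e) *\<^sub>R a1) \<bullet> (q - p0) \<le> 0"
          using e by linarith
        then show ?thesis
          using real by (simp add: order_trans)
      qed simp
    qed
  next
    case False
    then have pos: "a2 > 0" using a2 by simp
    show ?thesis
    \<comment> \<open>A non-vertical hyperplane is the graph of an affine function after division by
      a2.\<close>
    proof (rule that[of "- (1 / a2) *\<^sub>R a1"])
      fix q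
      show "ereal (\<alpha> + (- (1 / a2) *\<^sub>R a1) \<bullet> (q - p0)) \<le> enn2ereal (F q)"
      proof (cases "F q")
        case (real \<beta>)
        then have "a1 \<bullet> p0 + a2 * \<alpha> \<le> a1 \<bullet> q + a2 * \<beta>"
          using ab2[of \<beta> q] ab1 by simp
        then have "\<alpha> + (- (1 / a2) *\<^sub>R a1) \<bullet> (q - p0) \<le> \<beta>"
          using pos by (simp add: inner_diff_right field_simps)
        then show ?thesis
          using real by simp
      qed simp
    qed
  qed
qed

lemma continuous_on_Max_atMost:
  fixes h :: "nat \<Rightarrow> 'a::topological_space \<Rightarrow> real"
  assumes "\<And>i. i \<le> N \<Longrightarrow> continuous_on S (h i)"
  shows "continuous_on S (\<lambda>x. Max ((\<lambda>i. h i x) ` {..N}))"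
  using assms
proof (induction N)
  case (Suc N)
  have "Max ((\<lambda>i. h i x) ` {..Suc N}) = max (h (Suc N) x) (Max ((\<lambda>i. h i x) ` {..N}))" for x
    by (simp add: atMost_Suc)
  then show ?case
    using Suc by (auto intro!: continuous_on_max)
qed simp

text \<open>Index i gets a share proportional to the positive part of h i - M + \<epsilon>, so only
  indices within \<epsilon> of the maximum count, and the total A is at least \<epsilon>, which
  keeps the quotient continuous. The cut-off \<kappa> lets these shares be extended by zero.
  Replacing them from below by C^1 functions costs at most \<epsilon> per index, hence the term with
  the sum of |h i| in the error.\<close>

lemma C1_weights_near_maximum:
  fixes h :: "nat \<Rightarrow> 'a::euclidean_space \<Rightarrow> real"
  assumes \<Omega>: "open \<Omega>" "bounded \<Omega>" and h: "\<And>i. i \<le> N \<Longrightarrow> continuous_on \<Omega> (h i)"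
    and "0 < \<epsilon>" "0 < r"
  defines "\<kappa> \<equiv> \<lambda>x. max 0 (min 1 (r * infdist x (- \<Omega>) - 1))"
  obtains v K where "\<And>i. C1_on (v i) \<Omega>" "\<And>i x. 0 \<le> v i x" "\<And>x. x \<in> \<Omega> \<Longrightarrow> (\<Sum>i\<le>N. v i x) \<le> 1"
    "compact K" "K \<subseteq> \<Omega>" "\<And>i x. i \<le> N \<Longrightarrow> x \<in> \<Omega> - K \<Longrightarrow> v i x = 0"
    "\<And>x. x \<in> \<Omega> \<Longrightarrow> \<bar>(\<Sum>i\<le>N. v i x * h i x) - \<kappa> x * Max ((\<lambda>i. h i x) ` {..N})\<bar> \<le> \<epsilon> * (1 + (\<Sum>i\<le>N. \<bar>h i x\<bar>))"
proof -
  define M where "M x = Max ((\<lambda>i. h i x) ` {..N})" for x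
  define a where "a i x = max 0 (h i x - M x + \<epsilon>)" for i x
  define A where "A x = (\<Sum>i\<le>N. a i x)" for x
  define c where "c i x = (if x \<in> \<Omega> then \<kappa> x * a i x / A x else 0)" for i x
  define K where "K = {x. 1 / r \<le> infdist x (- \<Omega>)}"
  have M: "h i x \<le> M x" if "i \<le> N" for i x
    using that by (auto simp: M_def)
  have a0: "0 \<le> a i x" for i x
    by (simp add: a_def)
  have A: "\<epsilon> \<le> A x" for x
  proof -
    have "M x \<in> (\<lambda>i. h i x) ` {..N}"
      unfolding M_def by (intro Max_in) auto
    then obtain i where i: "i \<le> N" "M x = h i x" by auto
    then have "\<epsilon> \<le> a i x" by (simp add: a_def)
    also have "\<dots> \<le> A x"
      unfolding A_def using i a0 by (intro member_le_sum) auto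
    finally show ?thesis .
  qed
  have Apos: "A x > 0" for x
    using A[of x] \<open>0 < \<epsilon>\<close> by simp
  have \<kappa>: "0 \<le> \<kappa> x" "\<kappa> x \<le> 1" for x
    by (auto simp: \<kappa>_def)
  have \<kappa>0: "\<kappa> x = 0" if "x \<notin> K" for x
    using that \<open>0 < r\<close> by (auto simp: K_def \<kappa>_def field_simps)
  have contM: "continuous_on \<Omega> M"
    unfolding M_def using h by (rule continuous_on_Max_atMost)
  have conta: "continuous_on \<Omega> (a i)" if "i \<le> N" for i
    unfolding a_def using h[OF that] contM by (intro continuous_intros)
  have contA: "continuous_on \<Omega> A"
    unfolding A_def using conta by (intro continuous_on_sum) auto
  have "closed K"
    unfolding K_def by (intro closed_Collect_le continuous_intros)
  have "K \<subseteq> \<Omega>"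
  proof
    fix x assume "x \<in> K"
    then have "infdist x (- \<Omega>) \<noteq> 0"
      using \<open>0 < r\<close> by (auto simp: K_def)
    then show "x \<in> \<Omega>" by (metis ComplI infdist_zero)
  qed
  have "compact K"
    using \<open>closed K\<close> \<open>K \<subseteq> \<Omega>\<close> \<Omega>(2) bounded_subset compact_eq_bounded_closed by blast
  \<comment> \<open>The quotient formula on \<Omega> and the zero function off K are glued; both
    sets are open and they cover the space.\<close>
  have contc: "continuous_on UNIV (c i)" if "i \<le> N" for i
  proof -
    have "continuous_on \<Omega> (\<lambda>x. \<kappa> x * a i x / A x)"
      unfolding \<kappa>_def using conta[OF that] contA Apos
      by (intro continuous_intros) (auto simp: less_imp_neq[symmetric])
    then have "continuous_on \<Omega> (c i)"
      by (rule continuous_on_eq) (simp add: c_def)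
    moreover have "continuous_on (- K) (c i)"
      by (rule continuous_on_eq[OF continuous_on_const[of _ 0]]) (simp add: c_def \<kappa>0)
    ultimately have "continuous_on (\<Omega> \<union> - K) (c i)"
      using \<Omega>(1) \<open>closed K\<close> by (intro continuous_on_open_Un) auto
    moreover have "\<Omega> \<union> - K = UNIV" using \<open>K \<subseteq> \<Omega>\<close> by auto
    ultimately show ?thesis by simp
  qed
  have aA: "a i x \<le> A x" if "i \<le> N" for i x
    unfolding A_def using that a0 by (intro member_le_sum) auto
  have c: "0 \<le> c i x" for i x
    using \<kappa>(1)[of x] a0[of i x] Apos[of x] by (auto simp: c_def)
  have c1: "c i x \<le> 1" if "i \<le> N" for i x
    using mult_mono[OF \<kappa>(2)[of x] aA[OF that, of x]] \<kappa>(1)[of x] a0[of i x] Apos[of x]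
    by (auto simp: c_def)
  \<comment> \<open>Beyond N the zero function is taken, so that one family over all indices can be
    chosen.\<close>
  have "\<exists>v. C1_on v \<Omega> \<and> (\<forall>x. 0 \<le> v x) \<and> (\<forall>x\<in>\<Omega>. i \<le> N \<longrightarrow> v x \<le> c i x \<and> c i x - \<epsilon> \<le> v x)" for i
  proof (cases "i \<le> N")
    case True
    show ?thesis
      by (rule C1_approximation_from_below[OF \<Omega>(2) contc[OF True] c c1[OF True] \<open>0 < \<epsilon>\<close>]) blast
  next
    case False
    then show ?thesis by (intro exI[of _ "\<lambda>_. 0"]) (auto intro: C1_on_const)
  qed
  then obtain v where v: "\<And>i. C1_on (v i) \<Omega>" "\<And>i x. 0 \<le> v i x"
    "\<And>i x. x \<in> \<Omega> \<Longrightarrow> i \<le> N \<Longrightarrow> v i x \<le> c i x" "\<And>i x. x \<in> \<Omega> \<Longrightarrow> i \<le> N \<Longrightarrow> c i x - \<epsilon> \<le> v i x"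
    by metis
  have sumc: "(\<Sum>i\<le>N. c i x) = \<kappa> x" if "x \<in> \<Omega>" for x
    using that Apos[of x]
    by (simp add: c_def A_def sum_divide_distrib[symmetric] sum_distrib_left[symmetric])
  show ?thesis
  proof (rule that[of v K])
    fix x assume x: "x \<in> \<Omega>"
    have "(\<Sum>i\<le>N. v i x) \<le> (\<Sum>i\<le>N. c i x)"
      using v(3)[OF x] by (intro sum_mono) auto
    then show "(\<Sum>i\<le>N. v i x) \<le> 1"
      using sumc[OF x] \<kappa>(2)[of x] by simp
    have 1: "\<bar>(\<Sum>i\<le>N. v i x * h i x) - (\<Sum>i\<le>N. c i x * h i x)\<bar> \<le> \<epsilon> * (\<Sum>i\<le>N. \<bar>h i x\<bar>)"
    proof -
      have "\<bar>\<Sum>i\<le>N. (v i x - c i x) * h i x\<bar> \<le> (\<Sum>i\<le>N. \<bar>(v i x - c i x) * h i x\<bar>)"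
        by (rule sum_abs)
      also have "\<dots> \<le> (\<Sum>i\<le>N. \<epsilon> * \<bar>h i x\<bar>)"
      proof (intro sum_mono)
        fix i assume "i \<in> {..N}"
        then have "\<bar>v i x - c i x\<bar> \<le> \<epsilon>"
          using v(3,4)[OF x, of i] by (auto simp: abs_if)
        then show "\<bar>(v i x - c i x) * h i x\<bar> \<le> \<epsilon> * \<bar>h i x\<bar>"
          by (simp add: abs_mult mult_right_mono)
      qed
      finally show ?thesis
        by (simp add: left_diff_distrib sum_subtractf sum_distrib_left)
    qed
    have "c i x * (h i x - M x) \<le> 0 \<and> - \<epsilon> * c i x \<le> c i x * (h i x - M x)" if "i \<le> N" for i
    proof (cases "c i x = 0")
      case False
      then have "a i x \<noteq> 0" by (auto simp: c_def split: if_splits)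
      then have "- \<epsilon> \<le> h i x - M x" by (auto simp: a_def)
      then show ?thesis
        using c[of i x] M[OF that, of x] mult_left_mono[of "- \<epsilon>" "h i x - M x" "c i x"]
        by (auto simp: mult_nonneg_nonpos mult.commute)
    qed simp
    then have "(\<Sum>i\<le>N. c i x * (h i x - M x)) \<le> 0" "(\<Sum>i\<le>N. - \<epsilon> * c i x) \<le> (\<Sum>i\<le>N. c i x * (h i x - M x))"
      by (auto intro!: sum_nonpos sum_mono)
    moreover have "(\<Sum>i\<le>N. c i x * (h i x - M x)) = (\<Sum>i\<le>N. c i x * h i x) - \<kappa> x * M x"
      by (simp add: right_diff_distrib sum_subtractf sum_distrib_right[symmetric] sumc[OF x])
    moreover have "(\<Sum>i\<le>N. - \<epsilon> * c i x) = - \<epsilon> * \<kappa> x"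
      by (simp only: sum_distrib_left[symmetric] sumc[OF x])
    moreover have "\<epsilon> * \<kappa> x \<le> \<epsilon>"
      using \<kappa>[of x] \<open>0 < \<epsilon>\<close> by simp
    ultimately have "\<bar>(\<Sum>i\<le>N. c i x * h i x) - \<kappa> x * M x\<bar> \<le> \<epsilon>"
      by simp
    with 1 show "\<bar>(\<Sum>i\<le>N. v i x * h i x) - \<kappa> x * Max ((\<lambda>i. h i x) ` {..N})\<bar> \<le> \<epsilon> * (1 + (\<Sum>i\<le>N. \<bar>h i x\<bar>))"
      by (simp add: M_def distrib_left)
  next
    fix i x assume "i \<le> N" "x \<in> \<Omega> - K"
    then show "v i x = 0"
      using v(2)[of i x] v(3)[of x i] by (simp add: c_def \<kappa>0)
  qed (use v \<open>compact K\<close> \<open>K \<subseteq> \<Omega>\<close> in auto)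
qed

text \<open>The choice is \<epsilon> = 1 / (n + 1) and r = n + 1. The convergence is pointwise only:
  the sum of |h i| may be unbounded on \<Omega>, and the cut-off reaches 1 later for points nearer
  to the boundary.\<close>

lemma C1_weights_converging_to_maximum:
  fixes h :: "nat \<Rightarrow> 'a::euclidean_space \<Rightarrow> real"
  assumes \<Omega>: "open \<Omega>" "bounded \<Omega>" and h: "\<And>i. i \<le> N \<Longrightarrow> continuous_on \<Omega> (h i)"
  obtains v K where "\<And>n i. C1_on (v n i) \<Omega>" "\<And>n i x. 0 \<le> v n i x"
    "\<And>n x. x \<in> \<Omega> \<Longrightarrow> (\<Sum>i\<le>N. v n i x) \<le> 1"
    "\<And>n. compact (K n)" "\<And>n. K n \<subseteq> \<Omega>" "\<And>n i x. i \<le> N \<Longrightarrow> x \<in> \<Omega> - K n \<Longrightarrow> v n i x = 0"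
    "\<And>x. x \<in> \<Omega> \<Longrightarrow> (\<lambda>n. \<Sum>i\<le>N. v n i x * h i x) \<longlonglongrightarrow> Max ((\<lambda>i. h i x) ` {..N})"
proof -
  define \<epsilon> where "\<epsilon> n = inverse (real (Suc n))" for n
  define \<kappa> where "\<kappa> n x = max 0 (min 1 (real (Suc n) * infdist x (- \<Omega>) - 1))" for n x
  define M where "M x = Max ((\<lambda>i. h i x) ` {..N})" for x
  define P where "P n v K \<longleftrightarrow> (\<forall>i. C1_on (v i) \<Omega>) \<and> (\<forall>i x. 0 \<le> v i x) \<and> (\<forall>x\<in>\<Omega>. (\<Sum>i\<le>N. v i x) \<le> 1) \<and>
    compact K \<and> K \<subseteq> \<Omega> \<and> (\<forall>i\<le>N. \<forall>x\<in>\<Omega> - K. v i x = 0) \<and>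
    (\<forall>x\<in>\<Omega>. \<bar>(\<Sum>i\<le>N. v i x * h i x) - \<kappa> n x * M x\<bar> \<le> \<epsilon> n * (1 + (\<Sum>i\<le>N. \<bar>h i x\<bar>)))" for n v K
  have "\<exists>v K. P n v K" for n
  proof -
    have "0 < \<epsilon> n" "0 < real (Suc n)"
      by (simp_all add: \<epsilon>_def)
    with \<Omega> h show ?thesis
    proof (rule C1_weights_near_maximum)
      fix v K
      assume "\<And>i. C1_on (v i) \<Omega>" "\<And>i x. 0 \<le> v i x" "\<And>x. x \<in> \<Omega> \<Longrightarrow> (\<Sum>i\<le>N. v i x) \<le> 1"
        "compact K" "K \<subseteq> \<Omega>" "\<And>i x. i \<le> N \<Longrightarrow> x \<in> \<Omega> - K \<Longrightarrow> v i x = 0"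
        "\<And>x. x \<in> \<Omega> \<Longrightarrow> \<bar>(\<Sum>i\<le>N. v i x * h i x) - max 0 (min 1 (real (Suc n) * infdist x (- \<Omega>) - 1)) *
          Max ((\<lambda>i. h i x) ` {..N})\<bar> \<le> \<epsilon> n * (1 + (\<Sum>i\<le>N. \<bar>h i x\<bar>))"
      then show ?thesis
        unfolding P_def \<kappa>_def M_def by (intro exI[of _ v] exI[of _ K]) auto
    qed
  qed
  then obtain v K where "\<And>n. P n (v n) (K n)"
    by metis
  then have v: "\<And>n i. C1_on (v n i) \<Omega>" "\<And>n i x. 0 \<le> v n i x"
    "\<And>n x. x \<in> \<Omega> \<Longrightarrow> (\<Sum>i\<le>N. v n i x) \<le> 1"
    "\<And>n. compact (K n)" "\<And>n. K n \<subseteq> \<Omega>" "\<And>n i x. i \<le> N \<Longrightarrow> x \<in> \<Omega> - K n \<Longrightarrow> v n i x = 0"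
    "\<And>n x. x \<in> \<Omega> \<Longrightarrow> \<bar>(\<Sum>i\<le>N. v n i x * h i x) - \<kappa> n x * M x\<bar> \<le> \<epsilon> n * (1 + (\<Sum>i\<le>N. \<bar>h i x\<bar>))"
    unfolding P_def by auto
  show ?thesis
  proof (rule that[OF v(1-6)])
    fix x assume x: "x \<in> \<Omega>"
    \<comment> \<open>By convention \<open>infdist\<close> to the empty set is 0; boundedness of
      \<Omega> excludes this case.\<close>
    have "- \<Omega> \<noteq> {}"
      using \<Omega>(2) not_bounded_UNIV by (metis Compl_UNIV_eq double_complement)
    then have d: "0 < infdist x (- \<Omega>)"
      using \<Omega>(1) x by (intro infdist_pos_not_in_closed) auto
    have "\<forall>\<^sub>F n in sequentially. \<kappa> n x = 1"
    proof -
      \<comment> \<open>From n >= 2 / dist on, the expression (n + 1) dist - 1 is at least 1 and the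
        minimum in \<kappa> equals 1.\<close>
      obtain m where m: "2 / infdist x (- \<Omega>) < real m" using reals_Archimedean2 by blast
      show ?thesis
      proof (rule eventually_sequentiallyI[of m])
        fix n assume "m \<le> n"
        then have "2 / infdist x (- \<Omega>) \<le> real (Suc n)" using m by simp
        then have "2 \<le> real (Suc n) * infdist x (- \<Omega>)"
          using d by (simp add: divide_le_eq)
        then show "\<kappa> n x = 1" unfolding \<kappa>_def by simp
      qed
    qed
    then have "(\<lambda>n. \<kappa> n x) \<longlonglongrightarrow> 1"
      by (rule tendsto_eventually)
    then have "(\<lambda>n. \<kappa> n x * M x) \<longlonglongrightarrow> 1 * M x"
      by (intro tendsto_mult_right)
    moreover have "(\<lambda>n. (\<Sum>i\<le>N. v n i x * h i x) - \<kappa> n x * M x) \<longlonglongrightarrow> 0"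
    proof (rule Lim_null_comparison)
      show "\<forall>\<^sub>F n in sequentially. norm ((\<Sum>i\<le>N. v n i x * h i x) - \<kappa> n x * M x) \<le> \<epsilon> n * (1 + (\<Sum>i\<le>N. \<bar>h i x\<bar>))"
        using v(7)[OF x] by simp
      have "(\<lambda>n. \<epsilon> n * (1 + (\<Sum>i\<le>N. \<bar>h i x\<bar>))) \<longlonglongrightarrow> 0 * (1 + (\<Sum>i\<le>N. \<bar>h i x\<bar>))"
        unfolding \<epsilon>_def by (intro tendsto_mult_right LIMSEQ_inverse_real_of_nat)
      then show "(\<lambda>n. \<epsilon> n * (1 + (\<Sum>i\<le>N. \<bar>h i x\<bar>))) \<longlonglongrightarrow> 0" by simp
    qed
    ultimately show "(\<lambda>n. \<Sum>i\<le>N. v n i x * h i x) \<longlonglongrightarrow> Max ((\<lambda>i. h i x) ` {..N})"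
      using tendsto_add by (fastforce simp: M_def)
  qed
qed

section \<open>Derivatives along a graph and bounds for test functions\<close>

lemma frechet_derivative_zero_on_open:
  assumes "open V" "x \<in> V" "\<And>y. y \<in> V \<Longrightarrow> f y = 0"
  shows "frechet_derivative f (at x) = (\<lambda>_. 0)"
proof -
  have "(f has_derivative (\<lambda>_. 0)) (at x)"
    using has_derivative_transform_within_open[OF has_derivative_const assms(1,2), of 0 f] assms(3)
    by simp
  then show ?thesis
    by (rule frechet_derivative_at[symmetric])
qed

lemma continuous_on_grad:
  fixes u :: "real^'d \<Rightarrow> real^'s"
  assumes "C1_on u S"
  shows "continuous_on S (grad u)"
proof -
  obtain u' where u': "continuous_on S u'" "\<And>x. x \<in> S \<Longrightarrow> frechet_derivative u (at x) = blinfun_apply (u' x)"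
    using C1_on_frechet_derivative[OF assms] by metis
  have "continuous_on S (\<lambda>x. \<chi> i k. u' x (axis i 1) $ k)"
    using u'(1) by (intro continuous_intros)
  then show ?thesis
    by (rule continuous_on_eq) (simp add: grad_def u'(2))
qed

lemma continuous_on_div_x:
  fixes \<phi> :: "(real^'d) \<times> (real^'s) \<Rightarrow> real^'d"
  assumes "C1_on \<phi> S"
  shows "continuous_on S (div_x \<phi>)"
proof -
  obtain g' where g': "continuous_on S g'" "\<And>x. x \<in> S \<Longrightarrow> frechet_derivative \<phi> (at x) = blinfun_apply (g' x)"
    using C1_on_frechet_derivative[OF assms] by metis
  have "continuous_on S (\<lambda>t. \<Sum>i\<in>UNIV. g' t (axis i 1, 0) $ i)"
    using g'(1) by (intro continuous_intros)
  then show ?thesis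
    by (rule continuous_on_eq) (simp add: div_x_def g'(2))
qed

lemma continuous_on_grad_z:
  fixes \<phi> :: "(real^'d) \<times> (real^'s) \<Rightarrow> real^'d"
  assumes "C1_on \<phi> S"
  shows "continuous_on S (grad_z \<phi>)"
proof -
  obtain g' where g': "continuous_on S g'" "\<And>x. x \<in> S \<Longrightarrow> frechet_derivative \<phi> (at x) = blinfun_apply (g' x)"
    using C1_on_frechet_derivative[OF assms] by metis
  have "continuous_on S (\<lambda>t. \<chi> i k. g' t (0, axis k 1) $ i)"
    using g'(1) by (intro continuous_intros)
  then show ?thesis
    by (rule continuous_on_eq) (simp add: grad_z_def g'(2))
qed

text \<open>This is the chain rule in the directions (e_i, partial_i u), summed over i. In
  \<open>grad\<close> and in \<open>grad_z\<close> the first index belongs to \<Omega>, so the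
  resulting double sum is the Frobenius product.\<close>

lemma divergence_along_graph:
  fixes u :: "real^'d \<Rightarrow> real^'s" and \<phi> :: "(real^'d) \<times> (real^'s) \<Rightarrow> real^'d"
  assumes "\<phi> differentiable at (x, u x)" "u differentiable at x"
  shows "(\<Sum>i\<in>UNIV. frechet_derivative (\<lambda>y. \<phi> (y, u y) $ i) (at x) (axis i 1)) =
    div_x \<phi> (x, u x) + grad_z \<phi> (x, u x) \<bullet> grad u x"
proof -
  define \<phi>' where "\<phi>' = frechet_derivative \<phi> (at (x, u x))"
  define u' where "u' = frechet_derivative u (at x)"
  have \<phi>': "(\<phi> has_derivative \<phi>') (at (x, u x))"
    using assms(1) unfolding \<phi>'_def frechet_derivative_works .
  have u': "(u has_derivative u') (at x)"
    using assms(2) unfolding u'_def frechet_derivative_works .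
  have "((\<lambda>y. \<phi> (y, u y)) has_derivative (\<lambda>h. \<phi>' (h, u' h))) (at x)"
    by (rule has_derivative_compose[where f = "\<lambda>y. (y, u y)" and g = \<phi>])
      (auto intro!: derivative_eq_intros u' \<phi>')
  then have "((\<lambda>y. \<phi> (y, u y) $ i) has_derivative (\<lambda>h. \<phi>' (h, u' h) $ i)) (at x)" for i
    by (rule bounded_linear.has_derivative[OF bounded_linear_vec_nth])
  then have 1: "frechet_derivative (\<lambda>y. \<phi> (y, u y) $ i) (at x) = (\<lambda>h. \<phi>' (h, u' h) $ i)" for i
    by (rule frechet_derivative_at[symmetric])
  have lin: "linear \<phi>'"
    using \<phi>' by (rule has_derivative_linear)
  have "\<phi>' (axis i 1, u' (axis i 1)) $ i =
      \<phi>' (axis i 1, 0) $ i + (\<Sum>k\<in>UNIV. \<phi>' (0, axis k 1) $ i * u' (axis i 1) $ k)" for i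
  proof -
    \<comment> \<open>Expanding only the z-part of the direction in coordinates produces the entries
      of \<open>grad_z \<phi>\<close>.\<close>
    have "(axis i 1, u' (axis i 1)) =
        (axis i 1, 0) + (\<Sum>k\<in>UNIV. u' (axis i 1) $ k *\<^sub>R (0 :: real^'d, axis k 1 :: real^'s))"
      using basis_expansion[of "u' (axis i 1)"]
      by (simp add: prod_eq_iff fst_sum snd_sum scalar_mult_eq_scaleR)
    then show ?thesis
      by (simp add: linear_add[OF lin] linear_sum[OF lin] linear_scale[OF lin] mult.commute del: scaleR_Pair)
  qed
  then show ?thesis
    by (simp add: 1 div_x_def grad_z_def grad_def inner_vec_def \<phi>'_def[symmetric] u'_def[symmetric] sum.distrib)
qed

lemma C0_space_bounded:
  assumes "\<phi> \<in> C0_space S"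
  obtains B where "\<And>t. t \<in> S \<Longrightarrow> norm (\<phi> t) \<le> B"
proof -
  from assms obtain \<psi> where \<psi>: "\<And>n. \<psi> n \<in> Cc_space S" "uniform_limit S \<psi> \<phi> sequentially"
    unfolding C0_space_def by blast
  have "\<forall>\<^sub>F n in sequentially. \<forall>t\<in>S. dist (\<psi> n t) (\<phi> t) < 1"
    using uniform_limitD[OF \<psi>(2), of 1] by simp
  then obtain n where n: "\<And>t. t \<in> S \<Longrightarrow> dist (\<psi> n t) (\<phi> t) < 1"
    by (auto simp: eventually_sequentially)
  obtain K where K: "compact K" "K \<subseteq> S" "\<And>t. t \<in> S - K \<Longrightarrow> \<psi> n t = 0" "continuous_on S (\<psi> n)"
    using \<psi>(1)[of n] unfolding Cc_space_def by blast
  then have "bounded (\<psi> n ` K)"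
    by (intro compact_imp_bounded compact_continuous_image) (auto intro: continuous_on_subset)
  then obtain C where C: "C > 0" "\<And>t. t \<in> K \<Longrightarrow> norm (\<psi> n t) \<le> C"
    by (auto simp: bounded_pos)
  show ?thesis
  proof (rule that)
    fix t assume t: "t \<in> S"
    have "norm (\<psi> n t) \<le> C"
      using C K(3)[of t] t by (cases "t \<in> K") auto
    then show "norm (\<phi> t) \<le> C + 1"
      using n[OF t] norm_triangle_ineq2[of "\<phi> t" "\<psi> n t"] by (simp add: dist_norm norm_minus_commute)
  qed
qed

lemma Cc_space_subset_C0_space: "Cc_space S \<subseteq> C0_space S"
  unfolding C0_space_def by (auto simp: uniform_limit_iff intro!: exI[of _ "\<lambda>_. _"])

text \<open>A test function need not have compact support in z, but K \<times> \<Gamma> is compact.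
  For x in \<Omega> - K it vanishes for all z near the point as well, so its derivative is zero
  there.\<close>

lemma grad_z_bounded:
  assumes \<phi>: "\<phi> \<in> test_functions \<Omega>" and "compact \<Gamma>" "open \<Omega>"
  obtains B where "\<And>t. t \<in> \<Omega> \<times> \<Gamma> \<Longrightarrow> norm (grad_z \<phi> t) \<le> B"
proof -
  obtain K where K: "compact K" "K \<subseteq> \<Omega>" "\<And>x z. x \<in> \<Omega> - K \<Longrightarrow> \<phi> (x, z) = 0" and C1: "C1_on \<phi> (\<Omega> \<times> UNIV)"
    using \<phi> unfolding test_functions_def by blast
  have "bounded (grad_z \<phi> ` (K \<times> \<Gamma>))"
    using K assms(2) continuous_on_grad_z[OF C1]
    by (intro compact_imp_bounded compact_continuous_image compact_Times) (auto intro: continuous_on_subset)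
  then obtain B where B: "B > 0" "\<And>t. t \<in> K \<times> \<Gamma> \<Longrightarrow> norm (grad_z \<phi> t) \<le> B"
    unfolding bounded_pos by blast
  show ?thesis
  proof (rule that)
    fix t assume t: "t \<in> \<Omega> \<times> \<Gamma>"
    show "norm (grad_z \<phi> t) \<le> B"
    proof (cases "t \<in> K \<times> \<Gamma>")
      case False
      with t have "t \<in> (\<Omega> - K) \<times> UNIV" by auto
      then have "frechet_derivative \<phi> (at t) = (\<lambda>_. 0)"
        using K assms(3) by (intro frechet_derivative_zero_on_open[of "(\<Omega> - K) \<times> UNIV"])
          (auto intro!: open_Times open_Diff compact_imp_closed)
      then have "grad_z \<phi> t = 0"
        by (simp add: grad_z_def vec_eq_iff)
      then show ?thesis using B by simp
    qed (use B in auto)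
  qed
qed

text \<open>As \<phi> vanishes for x in \<Omega> - K whatever z is, x \<mapsto> \<phi> (x, u x) is
  supported in K, and each component can be integrated in its own coordinate direction.\<close>

lemma divergence_theorem_along_graph:
  fixes u :: "real^'d \<Rightarrow> real^'s"
  assumes \<phi>: "\<phi> \<in> test_functions \<Omega>" and "open \<Omega>" and u: "C1_on u \<Omega>"
  shows "integrable (restrict_space lborel \<Omega>) (\<lambda>x. div_x \<phi> (x, u x) + grad_z \<phi> (x, u x) \<bullet> grad u x)"
    and "(\<integral>x. div_x \<phi> (x, u x) + grad_z \<phi> (x, u x) \<bullet> grad u x \<partial>restrict_space lborel \<Omega>) = 0"
proof -
  obtain K where K: "compact K" "K \<subseteq> \<Omega>" "\<And>x z. x \<in> \<Omega> - K \<Longrightarrow> \<phi> (x, z) = 0" and C1: "C1_on \<phi> (\<Omega> \<times> UNIV)"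
    using \<phi> unfolding test_functions_def by blast
  let ?R = "restrict_space lborel \<Omega>"
  let ?d = "\<lambda>i x. frechet_derivative (\<lambda>y. \<phi> (y, u y) $ i) (at x) (axis i 1)"
  have "C1_on (\<lambda>y. \<phi> (y, u y)) \<Omega>"
    by (rule C1_on_compose[OF C1_on_Pair[OF C1_on_bounded_linear[OF bounded_linear_ident] u] C1]) auto
  then have C1i: "C1_on (\<lambda>y. \<phi> (y, u y) $ i) \<Omega>" for i
    using C1_on_compose[OF _ C1_on_bounded_linear[OF bounded_linear_vec_nth[of i]], of _ \<Omega> UNIV] by simp
  have int: "integrable ?R (?d i)" and zero: "(\<integral>x. ?d i x \<partial>?R) = 0" for i
    using K by (auto intro!: integral_directional_derivative_compact_support[OF assms(2) C1i K(1,2)])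
  have eq: "(\<Sum>i\<in>UNIV. ?d i x) = div_x \<phi> (x, u x) + grad_z \<phi> (x, u x) \<bullet> grad u x" if "x \<in> \<Omega>" for x
    using that C1 u unfolding C1_on_def
    by (intro divergence_along_graph) (auto simp: differentiable_def)
  have "integrable ?R (\<lambda>x. \<Sum>i\<in>UNIV. ?d i x)"
    by (intro Bochner_Integration.integrable_sum int)
  also have "integrable ?R (\<lambda>x. \<Sum>i\<in>UNIV. ?d i x) \<longleftrightarrow>
      integrable ?R (\<lambda>x. div_x \<phi> (x, u x) + grad_z \<phi> (x, u x) \<bullet> grad u x)"
    by (intro Bochner_Integration.integrable_cong) (auto simp: eq space_restrict_space)
  finally show "integrable ?R (\<lambda>x. div_x \<phi> (x, u x) + grad_z \<phi> (x, u x) \<bullet> grad u x)" .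
  have "(\<integral>x. div_x \<phi> (x, u x) + grad_z \<phi> (x, u x) \<bullet> grad u x \<partial>?R) = (\<integral>x. (\<Sum>i\<in>UNIV. ?d i x) \<partial>?R)"
    by (intro Bochner_Integration.integral_cong) (auto simp: eq space_restrict_space)
  also have "\<dots> = 0"
    by (simp add: Bochner_Integration.integral_sum[OF int] zero)
  finally show "(\<integral>x. div_x \<phi> (x, u x) + grad_z \<phi> (x, u x) \<bullet> grad u x \<partial>?R) = 0" .
qed

text \<open>This is Fenchel-Moreau. Continuity of G lets a slope be moved into the dense sequence at
  arbitrarily small loss; countability is what measurability and monotone convergence ask for
  later.\<close>

lemma biconjugate_on_dense_sequence:
  fixes F :: "'p::euclidean_space \<Rightarrow> ennreal" and \<Xi> :: "nat \<Rightarrow> 'p"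
  assumes conv: "convex_ennreal F" and lsc: "\<And>y. open {p. y < F p}" and p1: "F p1 < top"
    and G: "\<And>\<xi>. (SUP p. ereal (\<xi> \<bullet> p) - enn2ereal (F p)) = ereal (G \<xi>)" "continuous_on UNIV G"
    and dense: "\<And>X. open X \<Longrightarrow> X \<noteq> {} \<Longrightarrow> \<exists>n. \<Xi> n \<in> X"
  shows "F p = (SUP n. ennreal (\<Xi> n \<bullet> p - G (\<Xi> n)))"
proof (rule antisym)
  show "(SUP n. ennreal (\<Xi> n \<bullet> p - G (\<Xi> n))) \<le> F p"
  proof (rule SUP_least)
    fix n
    have "ereal (\<Xi> n \<bullet> p) - enn2ereal (F p) \<le> ereal (G (\<Xi> n))"
      unfolding G(1)[symmetric] by (rule SUP_upper) simp
    then show "ennreal (\<Xi> n \<bullet> p - G (\<Xi> n)) \<le> F p"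
      by (cases "F p") (auto simp: intro!: ennreal_leI)
  qed
  show "F p \<le> (SUP n. ennreal (\<Xi> n \<bullet> p - G (\<Xi> n)))"
  \<comment> \<open>F p may be infinite, so it is approached through finite levels below it. The
    intermediate level leaves room for perturbing the slope.\<close>
  proof (rule dense_le)
    fix y assume "y < F p"
    then obtain y' where y': "y < y'" "y' < F p" using Orderings.dense by blast
    from y' obtain \<alpha> where \<alpha>: "y' = ennreal \<alpha>" "0 \<le> \<alpha>"
      by (cases y') (auto simp: top.not_eq_extremum)
    obtain \<xi> where \<xi>: "\<And>q. ereal (\<alpha> + \<xi> \<bullet> (q - p)) \<le> enn2ereal (F q)"
      using convex_lsc_affine_minorant[OF conv lsc p1 \<alpha>(2)] y'(2) \<alpha>(1) by metis
    have "ereal (G \<xi>) \<le> ereal (\<xi> \<bullet> p - \<alpha>)"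
      unfolding G(1)[symmetric]
    proof (rule SUP_least)
      fix q
      show "ereal (\<xi> \<bullet> q) - enn2ereal (F q) \<le> ereal (\<xi> \<bullet> p - \<alpha>)"
        using \<xi>[of q] by (cases "F q") (auto simp: inner_diff_right)
    qed
    then have \<xi>G: "\<alpha> \<le> \<xi> \<bullet> p - G \<xi>" by simp
    show "y \<le> (SUP n. ennreal (\<Xi> n \<bullet> p - G (\<Xi> n)))"
    proof (cases y)
      case (real \<beta>)
      then have "\<beta> < \<alpha>" using y'(1) \<alpha> by (simp add: ennreal_less_iff)
      then have "{\<xi>. \<beta> < \<xi> \<bullet> p - G \<xi>} \<noteq> {}"
        using \<xi>G by (auto intro!: exI[of _ \<xi>])
      moreover have "open {\<xi>. \<beta> < \<xi> \<bullet> p - G \<xi>}"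
        by (intro open_Collect_less continuous_intros G(2))
      ultimately obtain n where "\<beta> < \<Xi> n \<bullet> p - G (\<Xi> n)"
        using dense by blast
      then show ?thesis
        using real by (intro SUP_upper2[of n]) (auto intro: ennreal_leI)
    qed (use y'(1) in auto)
  qed
qed

subsection \<open>The upper bound\<close>

locale graph_lifting =
  fixes \<Omega> :: "(real^'d) set" and \<Gamma> :: "(real^'s) set"
    and f :: "(real^'d) \<times> (real^'s) \<Rightarrow> real^'s^'d \<Rightarrow> ennreal"
    and u :: "real^'d \<Rightarrow> real^'s"
  assumes open_\<Omega>: "open \<Omega>" and bounded_\<Omega>: "bounded \<Omega>" and compact_\<Gamma>: "compact \<Gamma>"
    and lsc_f: "lsc_on ((\<Omega> \<times> \<Gamma>) \<times> UNIV) (\<lambda>(t, p). f t p)"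
    and convex_f: "\<forall>t\<in>\<Omega> \<times> \<Gamma>. convex_ennreal (f t)"
    and bounded_f: "locally_bounded_on (\<Omega> \<times> \<Gamma>) (\<lambda>t. f t 0)"
    and continuous_conj: "continuous_on ((\<Omega> \<times> \<Gamma>) \<times> UNIV) (\<lambda>(t, \<xi>). conj_last f t \<xi>)"
    and bounded_conj: "\<forall>r>0. (SUP (t, \<xi>)\<in>(\<Omega> \<times> \<Gamma>) \<times> {\<xi>. norm \<xi> < r}. \<bar>conj_last f t \<xi>\<bar>) < \<infinity>"
    and C1_u: "C1_on u \<Omega>" and range_u: "u ` \<Omega> \<subseteq> \<Gamma>"
    and finite_energy: "energy \<Omega> f u < \<infinity>"
begin

section \<open>Lebesgue measure on the domain and its image on the graph\<close>

definition R where "R = restrict_space lborel \<Omega>"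

definition G where "G = distr R (restrict_space borel (\<Omega> \<times> \<Gamma>)) (\<lambda>x. (x, u x))"

text \<open>The bound on balls makes the conjugate finite on U, so passing to reals loses nothing
  there, as \<open>conj_eq_fstar\<close> records.\<close>

definition fstar where "fstar t \<xi> = real_of_ereal (conj_last f t \<xi>)"

lemma space_R: "space R = \<Omega>"
  by (simp add: R_def space_restrict_space)

lemma measurable_R: "continuous_on \<Omega> h \<Longrightarrow> h \<in> borel_measurable R"
  using borel_measurable_continuous_on_restrict[of \<Omega> h]
  by (simp add: R_def cong: measurable_cong_sets sets_restrict_space_cong)

lemma finite_R: "finite_measure R"
proof (rule finite_measureI)
  have "emeasure lborel \<Omega> < \<infinity>"
    using bounded_\<Omega> by (rule emeasure_bounded_finite)
  then show "emeasure R (space R) \<noteq> \<infinity>"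
    unfolding space_R using open_\<Omega> by (simp add: R_def emeasure_restrict_space)
qed

lemma continuous_u: "continuous_on \<Omega> u"
  using C1_u by (rule C1_on_continuous_on)

lemma graph_in: "x \<in> \<Omega> \<Longrightarrow> (x, u x) \<in> \<Omega> \<times> \<Gamma>"
  using range_u by auto

lemma measurable_graph[measurable]: "(\<lambda>x. (x, u x)) \<in> measurable R (restrict_space borel (\<Omega> \<times> \<Gamma>))"
  using graph_in by (intro measurable_restrict_space2 measurable_R continuous_intros continuous_u)
    (auto simp: space_R)

lemma finite_G: "finite_measure G"
  unfolding G_def using finite_R measurable_graph by (rule finite_measure.finite_measure_distr)

lemma sets_G: "sets G = sets (restrict_space borel (\<Omega> \<times> \<Gamma>))"
  by (simp add: G_def)

lemma graph_measure_eq: "graph_measure \<Omega> \<Gamma> u = measure G"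
  by (simp add: graph_measure_def G_def R_def)

lemma measurable_G: "continuous_on (\<Omega> \<times> \<Gamma>) h \<Longrightarrow> h \<in> borel_measurable G"
  using borel_measurable_continuous_on_restrict[of "\<Omega> \<times> \<Gamma>" h]
  by (simp add: sets_G cong: measurable_cong_sets)

lemma integral_G:
  fixes h :: "_ \<Rightarrow> 'b::euclidean_space"
  assumes "continuous_on (\<Omega> \<times> \<Gamma>) h"
  shows "integral\<^sup>L G h = (\<integral>x. h (x, u x) \<partial>R)"
    and "integrable G h \<longleftrightarrow> integrable R (\<lambda>x. h (x, u x))"
  using borel_measurable_continuous_on_restrict[OF assms] unfolding G_def
  by (auto intro!: integral_distr integrable_distr_eq)

lemma signed_integral_graph:
  "continuous_on (\<Omega> \<times> \<Gamma>) h \<Longrightarrow>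
    signed_integral (\<Omega> \<times> \<Gamma>) h (graph_measure \<Omega> \<Gamma> u) = (\<integral>x. h (x, u x) \<partial>R)"
  by (simp add: graph_measure_eq signed_integral_measure[OF finite_G sets_G] integral_G)

section \<open>The conjugate as a finite continuous function\<close>

lemma conj_bounded:
  assumes "0 < r"
  obtains C where "\<And>t \<xi>. t \<in> \<Omega> \<times> \<Gamma> \<Longrightarrow> norm \<xi> < r \<Longrightarrow> \<bar>conj_last f t \<xi>\<bar> \<le> ereal C"
proof -
  define s where "s = (SUP (t, \<xi>)\<in>(\<Omega> \<times> \<Gamma>) \<times> {\<xi>. norm \<xi> < r}. \<bar>conj_last f t \<xi>\<bar>)"
  have "s < \<infinity>"
    using bounded_conj assms by (simp add: s_def)
  then obtain C where C: "s \<le> ereal C"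
    by (cases s) auto
  show ?thesis
  proof (rule that)
    fix t \<xi> assume "t \<in> \<Omega> \<times> \<Gamma>" "norm (\<xi> :: real^'s^'d) < r"
    then have "\<bar>conj_last f t \<xi>\<bar> \<le> s"
      unfolding s_def by (intro SUP_upper2[of "(t, \<xi>)"]) auto
    then show "\<bar>conj_last f t \<xi>\<bar> \<le> ereal C"
      using C by (rule order_trans)
  qed
qed

lemma conj_eq_fstar:
  assumes "t \<in> \<Omega> \<times> \<Gamma>"
  shows "conj_last f t \<xi> = ereal (fstar t \<xi>)"
proof -
  obtain C where "\<bar>conj_last f t \<xi>\<bar> \<le> ereal C"
    using conj_bounded[of "norm \<xi> + 1"] assms
    by (metis add_nonneg_pos less_add_one norm_ge_zero zero_less_one)
  then have "\<bar>conj_last f t \<xi>\<bar> \<noteq> \<infinity>"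
    by auto
  then show ?thesis
    by (simp add: fstar_def ereal_real)
qed

lemma fstar_bounded:
  assumes "0 < r"
  obtains C where "\<And>t \<xi>. t \<in> \<Omega> \<times> \<Gamma> \<Longrightarrow> norm \<xi> < r \<Longrightarrow> \<bar>fstar t \<xi>\<bar> \<le> C"
  using conj_bounded[OF assms] conj_eq_fstar by (metis abs_ereal.simps(1) ereal_less_eq(3))

lemma continuous_fstar: "continuous_on ((\<Omega> \<times> \<Gamma>) \<times> UNIV) (\<lambda>(t, \<xi>). fstar t \<xi>)"
proof -
  have "continuous_on ((\<Omega> \<times> \<Gamma>) \<times> UNIV) (real_of_ereal \<circ> (\<lambda>(t, \<xi>). conj_last f t \<xi>))"
    using continuous_conj conj_eq_fstar
    by (subst continuous_on_iff_real[symmetric]) auto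
  then show ?thesis
    by (simp add: comp_def fstar_def case_prod_unfold)
qed

lemma continuous_fstar_fixed: "continuous_on (\<Omega> \<times> \<Gamma>) (\<lambda>t. fstar t \<xi>)"
proof -
  have "continuous_on (\<Omega> \<times> \<Gamma>) (\<lambda>t. (t, \<xi>))"
    by (intro continuous_intros)
  from continuous_on_compose2[OF continuous_fstar this] show ?thesis
    by auto
qed

lemma Fenchel_inequality:
  assumes "t \<in> \<Omega> \<times> \<Gamma>"
  shows "ereal (\<xi> \<bullet> p - fstar t \<xi>) \<le> enn2ereal (f t p)"
proof -
  have "ereal (\<xi> \<bullet> p) - enn2ereal (f t p) \<le> ereal (fstar t \<xi>)"
    unfolding conj_eq_fstar[OF assms, symmetric] conj_last_def by (rule SUP_upper) simp
  then show ?thesis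
    by (cases "f t p") auto
qed

text \<open>Since f has values in [0, \<infinity>], every term of the supremum for slope 0 is
  nonpositive. This yields h 0 >= 0 and nonnegative maxima.\<close>

lemma fstar_zero_nonpos: "t \<in> \<Omega> \<times> \<Gamma> \<Longrightarrow> fstar t 0 \<le> 0"
proof -
  assume t: "t \<in> \<Omega> \<times> \<Gamma>"
  have "conj_last f t 0 \<le> 0"
    unfolding conj_last_def by (rule SUP_least) (simp add: ereal_minus_le_iff zero_ereal_def[symmetric])
  then show ?thesis
    using conj_eq_fstar[OF t] by simp
qed

lemma f_eq_SUP:
  assumes "t \<in> \<Omega> \<times> \<Gamma>" and "\<And>X :: (real^'s^'d) set. open X \<Longrightarrow> X \<noteq> {} \<Longrightarrow> \<exists>n. \<Xi> n \<in> X"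
  shows "f t p = (SUP n :: nat. ennreal (\<Xi> n \<bullet> p - fstar t (\<Xi> n)))"
proof (rule biconjugate_on_dense_sequence)
  show "convex_ennreal (f t)"
    using convex_f assms(1) by blast
  show "open {p. y < f t p}" for y
  proof -
    obtain T where T: "open T" "{x \<in> (\<Omega> \<times> \<Gamma>) \<times> UNIV. y < (case x of (t, p) \<Rightarrow> f t p)} = (\<Omega> \<times> \<Gamma>) \<times> UNIV \<inter> T"
      using lsc_on_openin_superlevel[OF lsc_f] unfolding openin_open by blast
    have "{p. y < f t p} = (\<lambda>p. (t, p)) -` T"
      using T(2) assms(1) by auto
    then show ?thesis
      using T(1) by (simp add: open_vimage continuous_intros)
  qed
  \<comment> \<open>Local boundedness at p = 0 provides the point of finiteness from which minorants
    are built.\<close>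
  show "f t 0 < top"
    using bounded_f assms(1) unfolding locally_bounded_on_def
    by (meson IntI ennreal_less_top le_less_trans)
  show "(SUP p. ereal (\<xi> \<bullet> p) - enn2ereal (f t p)) = ereal (fstar t \<xi>)" for \<xi>
    using conj_eq_fstar[OF assms(1)] by (simp add: conj_last_def)
  have "continuous_on UNIV (\<lambda>\<xi> :: real^'s^'d. (t, \<xi>))"
    by (intro continuous_intros)
  from continuous_on_compose2[OF continuous_fstar this] show "continuous_on UNIV (fstar t)"
    using assms(1) by auto
qed (rule assms(2))

text \<open>The slope 0 stands at index 0 so that it takes part in every maximum over {..N} and
  keeps it nonnegative.\<close>

definition \<Xi> :: "nat \<Rightarrow> real^'s^'d"
  where "\<Xi> = (SOME \<Xi>. \<Xi> 0 = 0 \<and> (\<forall>X. open X \<longrightarrow> X \<noteq> {} \<longrightarrow> (\<exists>n. \<Xi> n \<in> X)))"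

lemma \<Xi>: "\<Xi> 0 = 0" "open X \<Longrightarrow> X \<noteq> {} \<Longrightarrow> \<exists>n. \<Xi> n \<in> X"
proof -
  obtain D :: "(real^'s^'d) set" where D: "countable D" "\<And>X. open X \<Longrightarrow> X \<noteq> {} \<Longrightarrow> \<exists>d\<in>D. d \<in> X"
    using countable_dense_setE by blast
  then have "D \<noteq> {}"
    using open_UNIV by blast
  \<comment> \<open>Prepending 0 to an enumeration of a dense set shifts the indices by one, whence
    the witness \<open>Suc n\<close>.\<close>
  have "\<exists>n. case_nat 0 (from_nat_into D) n \<in> X" if X: "open X" "X \<noteq> {}" for X
  proof -
    obtain d where "d \<in> D" "d \<in> X" using D(2)[OF X] by blast
    then obtain n where "from_nat_into D n = d"
      using D(1) from_nat_into_surj by metis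
    with \<open>d \<in> X\<close> show ?thesis
      by (intro exI[of _ "Suc n"]) simp
  qed
  then have "\<exists>\<Xi> :: nat \<Rightarrow> real^'s^'d. \<Xi> 0 = 0 \<and> (\<forall>X. open X \<longrightarrow> X \<noteq> {} \<longrightarrow> (\<exists>n. \<Xi> n \<in> X))"
    by (intro exI[of _ "case_nat 0 (from_nat_into D)"]) auto
  then have "\<Xi> 0 = 0 \<and> (\<forall>X. open X \<longrightarrow> X \<noteq> {} \<longrightarrow> (\<exists>n. \<Xi> n \<in> X))"
    unfolding \<Xi>_def by (rule someI_ex)
  then show "\<Xi> 0 = 0" "open X \<Longrightarrow> X \<noteq> {} \<Longrightarrow> \<exists>n. \<Xi> n \<in> X"
    by auto
qed

definition h where "h n x = \<Xi> n \<bullet> grad u x - fstar (x, u x) (\<Xi> n)"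

lemma continuous_grad_u: "continuous_on \<Omega> (grad u)"
  using C1_u by (rule continuous_on_grad)

lemma continuous_fstar_graph: "continuous_on \<Omega> (\<lambda>x. fstar (x, u x) \<xi>)"
proof -
  have "continuous_on \<Omega> (\<lambda>x. (x, u x))"
    by (intro continuous_intros continuous_u)
  from continuous_on_compose2[OF continuous_fstar_fixed this] graph_in show ?thesis
    by blast
qed

lemma continuous_h: "continuous_on \<Omega> (h n)"
  unfolding h_def by (intro continuous_intros continuous_grad_u continuous_fstar_graph)

lemma f_graph_eq_SUP: "x \<in> \<Omega> \<Longrightarrow> f (x, u x) (grad u x) = (SUP n. ennreal (h n x))"
  unfolding h_def using \<Xi>(2) by (intro f_eq_SUP graph_in)

text \<open>Along the graph f is a countable supremum of continuous functions.\<close>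

lemma measurable_f_graph: "(\<lambda>x. f (x, u x) (grad u x)) \<in> borel_measurable R"
proof -
  have [measurable]: "h n \<in> borel_measurable R" for n
    by (intro measurable_R continuous_h)
  have "(\<lambda>x. SUP n. ennreal (h n x)) \<in> borel_measurable R"
    by measurable
  then show ?thesis
    by (rule measurable_cong[THEN iffD1, rotated]) (simp add: f_graph_eq_SUP space_R)
qed

lemma energy_eq: "energy \<Omega> f u = (\<integral>\<^sup>+x. f (x, u x) (grad u x) \<partial>R)"
  unfolding energy_def R_def using open_\<Omega> by (simp add: nn_integral_restrict_space)

text \<open>With p = grad u x and the slope \<open>sgn p\<close>, the Fenchel inequality reads |p|
  <= f + f*(sgn p) <= f + C; the right side is integrable because the energy and the volume of
  \<Omega> are finite.\<close>

lemma integrable_grad_u: "integrable R (grad u)"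
proof (rule integrableI_bounded)
  show "grad u \<in> borel_measurable R"
    by (intro measurable_R continuous_grad_u)
  \<comment> \<open>The bound is available on open balls, so radius 2 is taken to contain the unit
    vectors.\<close>
  obtain C where C: "\<And>t \<xi>. t \<in> \<Omega> \<times> \<Gamma> \<Longrightarrow> norm \<xi> < 2 \<Longrightarrow> \<bar>fstar t \<xi>\<bar> \<le> C"
    using fstar_bounded[of 2] by auto
  have "(\<integral>\<^sup>+x. ennreal (norm (grad u x)) \<partial>R) \<le> (\<integral>\<^sup>+x. f (x, u x) (grad u x) + ennreal C \<partial>R)"
  proof (rule nn_integral_mono)
    fix x assume "x \<in> space R"
    then have t: "(x, u x) \<in> \<Omega> \<times> \<Gamma>"
      using graph_in by (simp add: space_R)
    let ?p = "grad u x"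
    have "norm (sgn ?p) < 2"
      by (simp add: norm_sgn)
    then have "fstar (x, u x) (sgn ?p) \<le> C" "0 \<le> C"
      using C[OF t, of "sgn ?p"] by auto
    moreover have "sgn ?p \<bullet> ?p = norm ?p"
      by (cases "?p = 0") (simp_all add: sgn_div_norm dot_square_norm power2_eq_square)
    ultimately show "ennreal (norm ?p) \<le> f (x, u x) ?p + ennreal C"
      using Fenchel_inequality[OF t, of "sgn ?p" ?p]
      by (cases "f (x, u x) ?p") (auto simp flip: ennreal_plus intro!: ennreal_leI)
  qed
  also have "\<dots> = energy \<Omega> f u + ennreal C * emeasure R (space R)"
    using measurable_f_graph by (simp add: nn_integral_add energy_eq)
  also have "\<dots> < \<infinity>"
    using finite_energy finite_measure.emeasure_finite[OF finite_R, of "space R"]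
    by (auto simp: ennreal_mult_less_top less_top)
  finally show "(\<integral>\<^sup>+x. ennreal (norm (grad u x)) \<partial>R) < \<infinity>" .
qed

lemma integrable_fstar_graph: "integrable R (\<lambda>x. fstar (x, u x) \<xi>)"
proof -
  obtain C where "\<And>t \<xi>'. t \<in> \<Omega> \<times> \<Gamma> \<Longrightarrow> norm \<xi>' < norm \<xi> + 1 \<Longrightarrow> \<bar>fstar t \<xi>'\<bar> \<le> C"
    using fstar_bounded[of "norm \<xi> + 1"] by (metis add_nonneg_pos norm_ge_zero zero_less_one)
  then have "AE x in R. norm (fstar (x, u x) \<xi>) \<le> C"
    using graph_in by (intro AE_I2) (simp add: space_R)
  then show ?thesis
    by (intro finite_measure.integrable_const_bound[OF finite_R] measurable_R continuous_fstar_graph)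
qed

lemma integrable_h: "integrable R (h n)"
  unfolding h_def by (intro Bochner_Integration.integrable_diff integrable_fstar_graph
      integrable_inner_right integrable_grad_u)

section \<open>The competitor attaining the energy\<close>

definition E where "E A = (LINT t:A|G. grad u (fst t))"

lemma continuous_grad_u_fst: "continuous_on (\<Omega> \<times> \<Gamma>) (\<lambda>t. grad u (fst t))"
  by (intro continuous_on_compose2[OF continuous_grad_u] continuous_intros) auto

lemma integrable_grad_u_G: "integrable G (\<lambda>t. grad u (fst t))"
  using integrable_grad_u by (simp add: integral_G(2)[OF continuous_grad_u_fst])

lemma E_vector_measure: "E \<in> vector_measures (\<Omega> \<times> \<Gamma>)"
  unfolding E_def by (intro set_integral_vector_measures sets_G integrable_grad_u_G)

lemma pairing_E:
  assumes "continuous_on (\<Omega> \<times> \<Gamma>) \<phi>" and "\<And>t. t \<in> \<Omega> \<times> \<Gamma> \<Longrightarrow> norm (\<phi> t) \<le> B"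
  shows "pairing_integral (\<Omega> \<times> \<Gamma>) \<phi> E = (\<integral>x. \<phi> (x, u x) \<bullet> grad u x \<partial>R)"
    and "integrable R (\<lambda>x. \<phi> (x, u x) \<bullet> grad u x)"
proof -
  note * = pairing_integral_set_integral[OF sets_G integrable_grad_u_G measurable_G[OF assms(1)] assms(2)]
  have cont: "continuous_on (\<Omega> \<times> \<Gamma>) (\<lambda>t. \<phi> t \<bullet> grad u (fst t))"
    by (intro continuous_intros assms(1) continuous_grad_u_fst)
  show "pairing_integral (\<Omega> \<times> \<Gamma>) \<phi> E = (\<integral>x. \<phi> (x, u x) \<bullet> grad u x \<partial>R)"
    using *(2) unfolding E_def[abs_def] integral_G(1)[OF cont] by simp
  show "integrable R (\<lambda>x. \<phi> (x, u x) \<bullet> grad u x)"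
    using *(1) unfolding integral_G(2)[OF cont] by simp
qed

lemma E_admissible:
  assumes \<phi>: "\<phi> \<in> test_functions \<Omega>"
  shows "signed_integral (\<Omega> \<times> \<Gamma>) (div_x \<phi>) (graph_measure \<Omega> \<Gamma> u) +
    pairing_integral (\<Omega> \<times> \<Gamma>) (grad_z \<phi>) E = 0"
proof -
  have C1: "C1_on \<phi> (\<Omega> \<times> \<Gamma>)"
    using \<phi> unfolding test_functions_def by (auto elim: C1_on_subset)
  obtain B where B: "\<And>t. t \<in> \<Omega> \<times> \<Gamma> \<Longrightarrow> norm (grad_z \<phi> t) \<le> B"
    using grad_z_bounded[OF \<phi> compact_\<Gamma> open_\<Omega>] by blast
  note P = pairing_E[OF continuous_on_grad_z[OF C1] B]
  note D = divergence_theorem_along_graph[OF \<phi> open_\<Omega> C1_u, folded R_def]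
  \<comment> \<open>The divergence theorem gives integrability of the sum; the integral of
    \<open>div_x \<phi>\<close> is recovered by subtracting the gradient term, whose integrability
    is known from \<open>P\<close>.\<close>
  have "(\<integral>x. div_x \<phi> (x, u x) \<partial>R) =
      (\<integral>x. (div_x \<phi> (x, u x) + grad_z \<phi> (x, u x) \<bullet> grad u x) - grad_z \<phi> (x, u x) \<bullet> grad u x \<partial>R)"
    by simp
  also have "\<dots> = 0 - (\<integral>x. grad_z \<phi> (x, u x) \<bullet> grad u x \<partial>R)"
    by (subst Bochner_Integration.integral_diff[OF D(1) P(2)]) (simp_all add: D(2))
  finally show ?thesis
    by (simp add: signed_integral_graph[OF continuous_on_div_x[OF C1]] P(1))
qed

lemma BB_functional_E_le: "BB_functional (\<Omega> \<times> \<Gamma>) f (E, graph_measure \<Omega> \<Gamma> u) \<le> enn2ereal (energy \<Omega> f u)"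
  unfolding BB_functional_def prod.case
proof (rule SUP_least)
  fix \<phi> assume "\<phi> \<in> BB_admissible (\<Omega> \<times> \<Gamma>) f"
  then have \<phi>: "\<phi> \<in> C0_space (\<Omega> \<times> \<Gamma>)"
    and adm: "\<And>t. t \<in> \<Omega> \<times> \<Gamma> \<Longrightarrow> conj_last f t (fst (\<phi> t)) + ereal (snd (\<phi> t)) \<le> 0"
    by (auto simp: BB_admissible_def)
  have cont: "continuous_on (\<Omega> \<times> \<Gamma>) (\<lambda>t. fst (\<phi> t))" "continuous_on (\<Omega> \<times> \<Gamma>) (\<lambda>t. snd (\<phi> t))"
    using C0_space_continuous_on[OF \<phi>] by (auto intro!: continuous_intros)
  obtain B where B: "\<And>t. t \<in> \<Omega> \<times> \<Gamma> \<Longrightarrow> norm (\<phi> t) \<le> B"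
    using C0_space_bounded[OF \<phi>] by blast
  have B1: "norm (fst (\<phi> t)) \<le> B" "norm (snd (\<phi> t)) \<le> B" if "t \<in> \<Omega> \<times> \<Gamma>" for t
    using B[OF that] norm_fst_le[of "fst (\<phi> t)" "snd (\<phi> t)"] norm_snd_le[of "snd (\<phi> t)" "fst (\<phi> t)"] by auto
  note P = pairing_E[OF cont(1) B1(1)]
  let ?s = "\<lambda>x. fst (\<phi> (x, u x)) \<bullet> grad u x + snd (\<phi> (x, u x))"
  have cont2: "continuous_on \<Omega> (\<lambda>x. snd (\<phi> (x, u x)))"
    using graph_in by (intro continuous_on_compose2[OF cont(2)] continuous_intros continuous_u) auto
  have int2: "integrable R (\<lambda>x. snd (\<phi> (x, u x)))"
    using B1(2) graph_in by (intro finite_measure.integrable_const_bound[OF finite_R, of _ B]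
        measurable_R cont2 AE_I2) (simp add: space_R)
  \<comment> \<open>Admissibility bounds \<open>snd (\<phi> t)\<close> by minus the conjugate at
    \<open>fst (\<phi> t)\<close>, which turns the integrand into the left side of the Fenchel
    inequality.\<close>
  have le: "ennreal (?s x) \<le> f (x, u x) (grad u x)" if "x \<in> \<Omega>" for x
    using adm[OF graph_in[OF that]] Fenchel_inequality[OF graph_in[OF that], of "fst (\<phi> (x, u x))" "grad u x"]
    by (cases "f (x, u x) (grad u x)") (auto simp: conj_eq_fstar[OF graph_in[OF that]] intro!: ennreal_leI)
  have "ennreal (\<integral>x. ?s x \<partial>R) \<le> (\<integral>\<^sup>+x. ennreal (?s x) \<partial>R)"
    by (intro integral_le_nn_integral Bochner_Integration.integrable_add P(2) int2)
  also have "\<dots> \<le> energy \<Omega> f u"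
    unfolding energy_eq using le by (intro nn_integral_mono) (simp add: space_R)
  \<comment> \<open>The truncation by \<open>ennreal\<close> can be undone: a negative integral lies
    below the nonnegative energy anyway.\<close>
  finally have "ereal (\<integral>x. ?s x \<partial>R) \<le> enn2ereal (energy \<Omega> f u)"
    using finite_energy by (cases "energy \<Omega> f u") (auto simp: ennreal_le_iff2)
  moreover have "(\<integral>x. ?s x \<partial>R) = pairing_integral (\<Omega> \<times> \<Gamma>) (\<lambda>t. fst (\<phi> t)) E +
      signed_integral (\<Omega> \<times> \<Gamma>) (\<lambda>t. snd (\<phi> t)) (graph_measure \<Omega> \<Gamma> u)"
    by (simp add: Bochner_Integration.integral_add[OF P(2) int2] P(1) signed_integral_graph[OF cont(2)])
  ultimately show "ereal (pairing_integral (\<Omega> \<times> \<Gamma>) (\<lambda>t. fst (\<phi> t)) E +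
      signed_integral (\<Omega> \<times> \<Gamma>) (\<lambda>t. snd (\<phi> t)) (graph_measure \<Omega> \<Gamma> u)) \<le> enn2ereal (energy \<Omega> f u)"
    by simp
qed

lemma lifted_functional_le: "lifted_functional \<Omega> \<Gamma> f (graph_measure \<Omega> \<Gamma> u) \<le> enn2ereal (energy \<Omega> f u)"
  unfolding lifted_functional_def
  using E_vector_measure E_admissible by (intro INF_lower2[of E] BB_functional_E_le) auto

end

subsection \<open>The lower bound\<close>

context graph_lifting begin

text \<open>The test function \<open>\<phi> (x, z) = A x *v (z - u x)\<close> vanishes on the graph, so there
  \<open>div_x \<phi> = - \<nabla>\<^sub>z \<phi>\<^sup>T \<bullet> grad u\<close>, while \<open>\<nabla>\<^sub>z \<phi>\<^sup>T = A x\<close> everywhere. Hence the constraint determines the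
  integral against \<open>\<nu>\<close> of every field that does not depend on \<open>z\<close>.\<close>

lemma pairing_of_fields_independent_of_z:
  assumes \<nu>: "\<forall>\<phi>\<in>test_functions \<Omega>. signed_integral (\<Omega> \<times> \<Gamma>) (div_x \<phi>) (graph_measure \<Omega> \<Gamma> u) +
      pairing_integral (\<Omega> \<times> \<Gamma>) (grad_z \<phi>) \<nu> = 0"
    and v: "\<And>i. i \<in> I \<Longrightarrow> C1_on (v i) \<Omega>" "\<And>i x. i \<in> I \<Longrightarrow> x \<in> \<Omega> - K \<Longrightarrow> v i x = 0"
    and K: "compact K" "K \<subseteq> \<Omega>"
  shows "pairing_integral (\<Omega> \<times> \<Gamma>) (\<lambda>t. \<Sum>i\<in>I. v i (fst t) *\<^sub>R A i) \<nu> =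
    (\<integral>x. (\<Sum>i\<in>I. v i x *\<^sub>R A i) \<bullet> grad u x \<partial>R)"
proof -
  define \<phi> where "\<phi> t = (\<Sum>i\<in>I. v i (fst t) *\<^sub>R (A i *v (snd t - u (fst t))))" for t
  have C1_fst: "C1_on (\<lambda>t. g (fst t)) (\<Omega> \<times> UNIV)" if "C1_on g \<Omega>" for g :: "real^'d \<Rightarrow> 'b::real_normed_vector"
    by (rule C1_on_compose[OF C1_on_bounded_linear[OF bounded_linear_fst] that]) auto
  have C1_A: "C1_on (\<lambda>t. A i *v (snd t - u (fst t))) (\<Omega> \<times> UNIV)" for i
    using C1_on_compose[OF C1_on_diff[OF C1_on_bounded_linear[OF bounded_linear_snd] C1_fst[OF C1_u]]
        C1_on_bounded_linear[OF matrix_vector_mul_bounded_linear], of UNIV "A i"]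
    by simp
  have C1: "C1_on \<phi> (\<Omega> \<times> UNIV)"
    unfolding \<phi>_def by (intro C1_on_sum C1_on_scaleR C1_fst v(1) C1_A)
  have \<phi>: "\<phi> \<in> test_functions \<Omega>"
    unfolding test_functions_def using C1 K v(2) by (auto simp: \<phi>_def intro!: exI[of _ K])
  have grad: "grad_z \<phi> (x, z) = (\<Sum>i\<in>I. v i x *\<^sub>R A i)" if "x \<in> \<Omega>" for x z
  proof -
    define \<phi>' where "\<phi>' = frechet_derivative \<phi> (at (x, z))"
    have "\<phi> differentiable at (x, z)"
      using C1 that unfolding C1_on_def differentiable_def by auto
    then have "(\<phi> has_derivative \<phi>') (at (x, z))"
      unfolding \<phi>'_def frechet_derivative_works .
    \<comment> \<open>On the fibre over a fixed x the test function is affine in z, so its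
      z-derivative can be read off and compared.\<close>
    then have "((\<lambda>z. \<phi> (x, z)) has_derivative (\<lambda>w. \<phi>' (0, w))) (at z)"
      by (intro has_derivative_compose[where f = "\<lambda>z. (x, z)" and g = \<phi>])
        (auto intro!: derivative_eq_intros)
    moreover have "((\<lambda>z. \<phi> (x, z)) has_derivative (\<lambda>w. \<Sum>i\<in>I. v i x *\<^sub>R (A i *v w))) (at z)"
      unfolding \<phi>_def fst_conv snd_conv
      by (intro has_derivative_sum has_derivative_scaleR_right
          bounded_linear.has_derivative[OF matrix_vector_mul_bounded_linear])
        (auto intro!: derivative_eq_intros)
    ultimately have "(\<lambda>w. \<phi>' (0, w)) = (\<lambda>w. \<Sum>i\<in>I. v i x *\<^sub>R (A i *v w))"
      by (rule has_derivative_unique)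
    then have "\<phi>' (0, w) = (\<Sum>i\<in>I. v i x *\<^sub>R (A i *v w))" for w
      by metis
    then show ?thesis
      by (simp add: grad_z_def \<phi>'_def[symmetric] vec_eq_iff matrix_vector_mult_basis column_def)
  qed
  have div: "div_x \<phi> (x, u x) = - ((\<Sum>i\<in>I. v i x *\<^sub>R A i) \<bullet> grad u x)" if "x \<in> \<Omega>" for x
  proof -
    have "(\<Sum>i\<in>UNIV. frechet_derivative (\<lambda>y. \<phi> (y, u y) $ i) (at x) (axis i 1)) =
        div_x \<phi> (x, u x) + grad_z \<phi> (x, u x) \<bullet> grad u x"
      using that C1 C1_u unfolding C1_on_def
      by (intro divergence_along_graph) (auto simp: differentiable_def)
    moreover have "(\<lambda>y. \<phi> (y, u y) $ i) = (\<lambda>_. 0)" for i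
      by (simp add: \<phi>_def)
    ultimately show ?thesis
      by (simp add: grad[OF that])
  qed
  have "pairing_integral (\<Omega> \<times> \<Gamma>) (\<lambda>t. \<Sum>i\<in>I. v i (fst t) *\<^sub>R A i) \<nu> =
      pairing_integral (\<Omega> \<times> \<Gamma>) (grad_z \<phi>) \<nu>"
    by (rule pairing_integral_cong) (auto simp: grad)
  also have "\<dots> = - signed_integral (\<Omega> \<times> \<Gamma>) (div_x \<phi>) (graph_measure \<Omega> \<Gamma> u)"
    using \<nu>[rule_format, OF \<phi>] by simp
  also have "\<dots> = - (\<integral>x. div_x \<phi> (x, u x) \<partial>R)"
    by (subst signed_integral_graph) (auto intro!: continuous_on_div_x C1_on_subset[OF C1])
  also have "\<dots> = - (\<integral>x. - ((\<Sum>i\<in>I. v i x *\<^sub>R A i) \<bullet> grad u x) \<partial>R)"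
    by (intro arg_cong[where f = uminus] Bochner_Integration.integral_cong) (auto simp: div space_R)
  finally show ?thesis
    by simp
qed

text \<open>The first component is independent of z, so the constraint evaluates it without
  knowledge of \<nu>. The second depends on z through the conjugate, but the graph measure sees it
  at z = u x only. Compactness of K \<times> \<Gamma> puts the pair into
  \<open>Cc_space\<close>.\<close>

lemma BB_functional_ge_weighted:
  assumes \<nu>: "\<forall>\<phi>\<in>test_functions \<Omega>. signed_integral (\<Omega> \<times> \<Gamma>) (div_x \<phi>) (graph_measure \<Omega> \<Gamma> u) +
      pairing_integral (\<Omega> \<times> \<Gamma>) (grad_z \<phi>) \<nu> = 0"
    and v: "\<And>i. C1_on (v i) \<Omega>" "\<And>i x. 0 \<le> v i x" "\<And>x. x \<in> \<Omega> \<Longrightarrow> (\<Sum>i\<le>N. v i x) \<le> 1"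
    and K: "compact K" "K \<subseteq> \<Omega>" "\<And>i x. i \<le> N \<Longrightarrow> x \<in> \<Omega> - K \<Longrightarrow> v i x = 0"
  shows "ereal (\<integral>x. (\<Sum>i\<le>N. v i x * h i x) \<partial>R) \<le> BB_functional (\<Omega> \<times> \<Gamma>) f (\<nu>, graph_measure \<Omega> \<Gamma> u)"
proof -
  define a where "a t = (\<Sum>i\<le>N. v i (fst t) *\<^sub>R \<Xi> i)" for t :: "(real^'d) \<times> (real^'s)"
  define b where "b t = - (\<Sum>i\<le>N. v i (fst t) * fstar t (\<Xi> i))" for t
  have contv: "continuous_on \<Omega> (v i)" for i
    using v(1) by (rule C1_on_continuous_on)
  have contv_fst: "continuous_on (\<Omega> \<times> \<Gamma>) (\<lambda>t. v i (fst t))" for i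
    by (intro continuous_on_compose2[OF contv] continuous_intros) auto
  have cont_a: "continuous_on (\<Omega> \<times> \<Gamma>) a"
    unfolding a_def by (intro continuous_intros contv_fst)
  have cont_b: "continuous_on (\<Omega> \<times> \<Gamma>) b"
    unfolding b_def by (intro continuous_intros contv_fst continuous_fstar_fixed)
  have "(\<lambda>t. (a t, b t)) \<in> Cc_space (\<Omega> \<times> \<Gamma>)"
    unfolding Cc_space_def
  proof (intro CollectI conjI exI[of _ "K \<times> \<Gamma>"] ballI)
    show "continuous_on (\<Omega> \<times> \<Gamma>) (\<lambda>t. (a t, b t))"
      by (intro continuous_intros cont_a cont_b)
    show "compact (K \<times> \<Gamma>)"
      using K(1) compact_\<Gamma> by (rule compact_Times)
    fix t assume "t \<in> \<Omega> \<times> \<Gamma> - K \<times> \<Gamma>"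
    then have "fst t \<in> \<Omega> - K"
      by auto
    then have "v i (fst t) = 0" if "i \<in> {..N}" for i
      using K(3) that by simp
    then show "(a t, b t) = 0"
      by (simp add: a_def b_def zero_prod_def)
  qed (use K(2) in auto)
  moreover have "conj_last f t (a t) + ereal (b t) \<le> 0" if t: "t \<in> \<Omega> \<times> \<Gamma>" for t
  proof -
    have le1: "(\<Sum>i\<le>N. v i (fst t)) \<le> 1"
      using v(3)[of "fst t"] t by auto
    have "conj_last f t (a t) \<le> ereal (- b t)"
      unfolding conj_last_def
    proof (rule SUP_least)
      fix q
      show "ereal (a t \<bullet> q) - enn2ereal (f t q) \<le> ereal (- b t)"
      proof (cases "f t q")
        case (real \<beta>)
        have "\<Xi> i \<bullet> q - \<beta> \<le> fstar t (\<Xi> i)" for i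
          using Fenchel_inequality[OF t, of "\<Xi> i" q] real by simp
        then have "(\<Sum>i\<le>N. v i (fst t) * (\<Xi> i \<bullet> q - \<beta>)) \<le> - b t"
          unfolding b_def using v(2) by (auto intro!: sum_mono mult_left_mono)
        moreover have "(\<Sum>i\<le>N. v i (fst t) * (\<Xi> i \<bullet> q - \<beta>)) = a t \<bullet> q - (\<Sum>i\<le>N. v i (fst t)) * \<beta>"
          by (simp add: a_def inner_sum_left right_diff_distrib sum_subtractf sum_distrib_right)
        \<comment> \<open>As \<beta> >= 0, a total weight below 1 only helps: the averaged Fenchel
          inequalities still dominate the one with the full \<beta>.\<close>
        moreover have "(\<Sum>i\<le>N. v i (fst t)) * \<beta> \<le> \<beta>"
          using mult_right_mono[OF le1 real(1)] by simp
        ultimately show ?thesis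
          using real by simp
      qed simp
    qed
    then show ?thesis
      by (simp add: conj_eq_fstar[OF t])
  qed
  ultimately have "(\<lambda>t. (a t, b t)) \<in> BB_admissible (\<Omega> \<times> \<Gamma>) f"
    unfolding BB_admissible_def using Cc_space_subset_C0_space by auto
  then have "ereal (pairing_integral (\<Omega> \<times> \<Gamma>) a \<nu> + signed_integral (\<Omega> \<times> \<Gamma>) b (graph_measure \<Omega> \<Gamma> u))
      \<le> BB_functional (\<Omega> \<times> \<Gamma>) f (\<nu>, graph_measure \<Omega> \<Gamma> u)"
    unfolding BB_functional_def prod.case by (rule SUP_upper2) simp
  moreover have "pairing_integral (\<Omega> \<times> \<Gamma>) a \<nu> + signed_integral (\<Omega> \<times> \<Gamma>) b (graph_measure \<Omega> \<Gamma> u) =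
      (\<integral>x. (\<Sum>i\<le>N. v i x * h i x) \<partial>R)"
  proof -
    have vle: "\<bar>v i x\<bar> \<le> 1" if "i \<le> N" "x \<in> \<Omega>" for i x
      using member_le_sum[of i "{..N}" "\<lambda>i. v i x"] v(2,3) that by fastforce
    have int: "integrable R (\<lambda>x. v i x * g x)"
      if "i \<le> N" "integrable R g" "continuous_on \<Omega> g" for i and g :: "real^'d \<Rightarrow> real"
    proof (rule Bochner_Integration.integrable_bound[OF that(2)])
      show "(\<lambda>x. v i x * g x) \<in> borel_measurable R"
        by (intro measurable_R continuous_intros contv that(3))
      show "AE x in R. norm (v i x * g x) \<le> norm (g x)"
        using vle[OF that(1)] by (intro AE_I2) (auto simp: space_R abs_mult intro!: mult_left_le_one_le)
    qed
    have int1: "integrable R (\<lambda>x. (\<Sum>i\<le>N. v i x *\<^sub>R \<Xi> i) \<bullet> grad u x)"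
      unfolding inner_sum_left inner_scaleR_left
      by (intro Bochner_Integration.integrable_sum int integrable_inner_right integrable_grad_u
          continuous_intros continuous_grad_u) auto
    have int2: "integrable R (\<lambda>x. \<Sum>i\<le>N. v i x * fstar (x, u x) (\<Xi> i))"
      by (intro Bochner_Integration.integrable_sum int integrable_fstar_graph continuous_fstar_graph) auto
    have "pairing_integral (\<Omega> \<times> \<Gamma>) a \<nu> = (\<integral>x. (\<Sum>i\<le>N. v i x *\<^sub>R \<Xi> i) \<bullet> grad u x \<partial>R)"
      unfolding a_def using v(1) K by (intro pairing_of_fields_independent_of_z[OF \<nu>]) auto
    moreover have "signed_integral (\<Omega> \<times> \<Gamma>) b (graph_measure \<Omega> \<Gamma> u) =
        - (\<integral>x. (\<Sum>i\<le>N. v i x * fstar (x, u x) (\<Xi> i)) \<partial>R)"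
      by (subst signed_integral_graph[OF cont_b]) (simp add: b_def)
    ultimately have "pairing_integral (\<Omega> \<times> \<Gamma>) a \<nu> + signed_integral (\<Omega> \<times> \<Gamma>) b (graph_measure \<Omega> \<Gamma> u) =
        (\<integral>x. (\<Sum>i\<le>N. v i x *\<^sub>R \<Xi> i) \<bullet> grad u x - (\<Sum>i\<le>N. v i x * fstar (x, u x) (\<Xi> i)) \<partial>R)"
      by (simp add: Bochner_Integration.integral_diff[OF int1 int2])
    also have "\<dots> = (\<integral>x. (\<Sum>i\<le>N. v i x * h i x) \<partial>R)"
      by (intro Bochner_Integration.integral_cong)
        (auto simp: h_def inner_sum_left right_diff_distrib sum_subtractf)
    finally show ?thesis .
  qed
  ultimately show ?thesis
    by simp
qed

section \<open>From finite maxima to the energy\<close>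

definition M where "M N x = Max ((\<lambda>i. h i x) ` {..N})"

lemma abs_M_le: "\<bar>M N x\<bar> \<le> (\<Sum>i\<le>N. \<bar>h i x\<bar>)"
proof -
  have "M N x \<in> (\<lambda>i. h i x) ` {..N}"
    unfolding M_def by (intro Max_in) auto
  then obtain i where "i \<le> N" "M N x = h i x" by auto
  then show ?thesis
    using member_le_sum[of i "{..N}" "\<lambda>i. \<bar>h i x\<bar>"] by simp
qed

lemma measurable_M: "M N \<in> borel_measurable R"
  unfolding M_def by (intro measurable_R continuous_on_Max_atMost continuous_h)

lemma integrable_M: "integrable R (M N)"
proof (rule Bochner_Integration.integrable_bound)
  show "integrable R (\<lambda>x. \<Sum>i\<le>N. \<bar>h i x\<bar>)"
    by (intro Bochner_Integration.integrable_sum integrable_abs integrable_h)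
  show "AE x in R. norm (M N x) \<le> norm (\<Sum>i\<le>N. \<bar>h i x\<bar>)"
    using abs_M_le by (intro AE_I2) (simp add: sum_nonneg)
qed (rule measurable_M)

lemma M_nonneg: "x \<in> \<Omega> \<Longrightarrow> 0 \<le> M N x"
proof -
  assume "x \<in> \<Omega>"
  then have "0 \<le> h 0 x"
    using fstar_zero_nonpos[OF graph_in] by (simp add: h_def \<Xi>(1))
  also have "\<dots> \<le> M N x"
    unfolding M_def by (intro Max_ge) auto
  finally show ?thesis .
qed

text \<open>For fixed N the weights lie between 0 and 1, so the integrable sum of |h i| dominates
  and the weighted lower bounds converge to the integral of the maximum.\<close>

lemma integral_M_le_BB_functional:
  assumes \<nu>: "\<forall>\<phi>\<in>test_functions \<Omega>. signed_integral (\<Omega> \<times> \<Gamma>) (div_x \<phi>) (graph_measure \<Omega> \<Gamma> u) +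
      pairing_integral (\<Omega> \<times> \<Gamma>) (grad_z \<phi>) \<nu> = 0"
  shows "ereal (\<integral>x. M N x \<partial>R) \<le> BB_functional (\<Omega> \<times> \<Gamma>) f (\<nu>, graph_measure \<Omega> \<Gamma> u)"
proof -
  obtain v K where v: "\<And>n i. C1_on (v n i) \<Omega>" "\<And>n i x. 0 \<le> v n i x"
    "\<And>n x. x \<in> \<Omega> \<Longrightarrow> (\<Sum>i\<le>N. v n i x) \<le> 1"
    "\<And>n. compact (K n)" "\<And>n. K n \<subseteq> \<Omega>" "\<And>n i x. i \<le> N \<Longrightarrow> x \<in> \<Omega> - K n \<Longrightarrow> v n i x = 0"
    "\<And>x. x \<in> \<Omega> \<Longrightarrow> (\<lambda>n. \<Sum>i\<le>N. v n i x * h i x) \<longlonglongrightarrow> Max ((\<lambda>i. h i x) ` {..N})"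
    by (rule C1_weights_converging_to_maximum[OF open_\<Omega> bounded_\<Omega> continuous_h, where N = N]) (rule that)
  have "(\<lambda>n. \<integral>x. (\<Sum>i\<le>N. v n i x * h i x) \<partial>R) \<longlonglongrightarrow> (\<integral>x. M N x \<partial>R)"
  proof (rule integral_dominated_convergence[where w = "\<lambda>x. \<Sum>i\<le>N. \<bar>h i x\<bar>"])
    show "(\<lambda>x. \<Sum>i\<le>N. v n i x * h i x) \<in> borel_measurable R" for n
      by (intro measurable_R continuous_intros C1_on_continuous_on[OF v(1)] continuous_h)
    show "integrable R (\<lambda>x. \<Sum>i\<le>N. \<bar>h i x\<bar>)"
      by (intro Bochner_Integration.integrable_sum integrable_abs integrable_h)
    show "AE x in R. (\<lambda>n. \<Sum>i\<le>N. v n i x * h i x) \<longlonglongrightarrow> M N x"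
      using v(7) by (intro AE_I2) (simp add: space_R M_def)
    show "AE x in R. norm (\<Sum>i\<le>N. v n i x * h i x) \<le> (\<Sum>i\<le>N. \<bar>h i x\<bar>)" for n
    proof (rule AE_I2)
      fix x assume "x \<in> space R"
      then have x: "x \<in> \<Omega>" by (simp add: space_R)
      have "norm (\<Sum>i\<le>N. v n i x * h i x) \<le> (\<Sum>i\<le>N. norm (v n i x * h i x))"
        by (rule norm_sum)
      also have "\<dots> \<le> (\<Sum>i\<le>N. \<bar>h i x\<bar>)"
      proof (rule sum_mono)
        fix i assume i: "i \<in> {..N}"
        then have "v n i x \<le> (\<Sum>i\<le>N. v n i x)"
          using v(2) by (intro member_le_sum) auto
        then have "v n i x \<le> 1"
          using v(3)[OF x] by (rule order_trans)
        then show "norm (v n i x * h i x) \<le> \<bar>h i x\<bar>"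
          using v(2)[of n i x] by (simp add: abs_mult mult_left_le_one_le)
      qed
      finally show "norm (\<Sum>i\<le>N. v n i x * h i x) \<le> (\<Sum>i\<le>N. \<bar>h i x\<bar>)" .
    qed
  qed (rule measurable_M)
  then have "(\<lambda>n. ereal (\<integral>x. (\<Sum>i\<le>N. v n i x * h i x) \<partial>R)) \<longlonglongrightarrow> ereal (\<integral>x. M N x \<partial>R)"
    by simp
  then show ?thesis
    by (rule LIMSEQ_le_const2) (use BB_functional_ge_weighted[OF \<nu> v(1-6)] in blast)
qed

lemma energy_le_lifted_functional: "enn2ereal (energy \<Omega> f u) \<le> lifted_functional \<Omega> \<Gamma> f (graph_measure \<Omega> \<Gamma> u)"
  unfolding lifted_functional_def
proof (rule INF_greatest)
  fix \<nu> assume "\<nu> \<in> {E \<in> vector_measures (\<Omega> \<times> \<Gamma>). \<forall>\<phi>\<in>test_functions \<Omega>.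
      signed_integral (\<Omega> \<times> \<Gamma>) (div_x \<phi>) (graph_measure \<Omega> \<Gamma> u) +
      pairing_integral (\<Omega> \<times> \<Gamma>) (grad_z \<phi>) E = 0}"
  then have \<nu>: "\<forall>\<phi>\<in>test_functions \<Omega>. signed_integral (\<Omega> \<times> \<Gamma>) (div_x \<phi>) (graph_measure \<Omega> \<Gamma> u) +
      pairing_integral (\<Omega> \<times> \<Gamma>) (grad_z \<phi>) \<nu> = 0"
    by blast
  let ?B = "BB_functional (\<Omega> \<times> \<Gamma>) f (\<nu>, graph_measure \<Omega> \<Gamma> u)"
  have B: "ereal (\<integral>x. M N x \<partial>R) \<le> ?B" for N
    by (rule integral_M_le_BB_functional[OF \<nu>])
  have M0: "0 \<le> (\<integral>x. M N x \<partial>R)" for N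
    using M_nonneg by (intro integral_nonneg_AE AE_I2) (simp add: space_R)
  have "f (x, u x) (grad u x) = (SUP N. ennreal (M N x))" if "x \<in> \<Omega>" for x
  proof (rule antisym)
    show "f (x, u x) (grad u x) \<le> (SUP N. ennreal (M N x))"
      unfolding f_graph_eq_SUP[OF that]
      by (intro SUP_mono) (auto simp: M_def intro!: ennreal_leI Max_ge)
    show "(SUP N. ennreal (M N x)) \<le> f (x, u x) (grad u x)"
      unfolding f_graph_eq_SUP[OF that]
    proof (rule SUP_least)
      fix N
      have "M N x \<in> (\<lambda>i. h i x) ` {..N}"
        unfolding M_def by (intro Max_in) auto
      then obtain i where "M N x = h i x" by auto
      then show "ennreal (M N x) \<le> (SUP n. ennreal (h n x))"
        by (intro SUP_upper2[of i]) auto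
    qed
  qed
  then have "energy \<Omega> f u = (\<integral>\<^sup>+x. (SUP N. ennreal (M N x)) \<partial>R)"
    unfolding energy_eq by (intro nn_integral_cong) (simp add: space_R)
  also have "\<dots> = (SUP N. \<integral>\<^sup>+x. ennreal (M N x) \<partial>R)"
  proof (rule nn_integral_monotone_convergence_SUP)
    show "incseq (\<lambda>N x. ennreal (M N x))"
      unfolding incseq_def le_fun_def M_def by (intro allI impI ennreal_leI Max_mono) auto
  qed (use measurable_M in simp)
  also have "\<dots> = (SUP N. ennreal (\<integral>x. M N x \<partial>R))"
    using M_nonneg by (intro SUP_cong refl nn_integral_eq_integral integrable_M AE_I2) (simp add: space_R)
  \<comment> \<open>Monotone convergence lives in \<open>ennreal\<close>, so the bounds are
    transported there first.\<close>
  also have "\<dots> \<le> e2ennreal ?B"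
  proof (rule SUP_least)
    fix N
    have "ennreal (\<integral>x. M N x \<partial>R) = e2ennreal (ereal (\<integral>x. M N x \<partial>R))"
      by simp
    also have "\<dots> \<le> e2ennreal ?B"
      using B by (rule e2ennreal_mono)
    finally show "ennreal (\<integral>x. M N x \<partial>R) \<le> e2ennreal ?B" .
  qed
  finally have "enn2ereal (energy \<Omega> f u) \<le> enn2ereal (e2ennreal ?B)"
    by (simp add: less_eq_ennreal.rep_eq)
  \<comment> \<open>The bound for N = 0 already gives nonnegativity, so \<open>e2ennreal\<close> has
    not altered the functional and the inequality transfers back.\<close>
  moreover have "0 \<le> ?B"
    by (rule order_trans[OF _ B[of 0]]) (simp add: M0)
  ultimately show "enn2ereal (energy \<Omega> f u) \<le> ?B"
    by (simp add: enn2ereal_e2ennreal)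
qed

end

theorem mainTheorem4:
  fixes \<Omega> :: "(real^'d) set" and \<Gamma> :: "(real^'s) set"
    and f :: "(real^'d) \<times> (real^'s) \<Rightarrow> real^'s^'d \<Rightarrow> ennreal"
    and u :: "real^'d \<Rightarrow> real^'s"
  assumes "open \<Omega>" and "bounded \<Omega>" and "compact \<Gamma>"
    and "lsc_on ((\<Omega> \<times> \<Gamma>) \<times> UNIV) (\<lambda>(t, p). f t p)"
    and "\<forall>t\<in>\<Omega> \<times> \<Gamma>. convex_ennreal (f t)"
    and "locally_bounded_on (\<Omega> \<times> \<Gamma>) (\<lambda>t. f t 0)"
    and "continuous_on ((\<Omega> \<times> \<Gamma>) \<times> UNIV) (\<lambda>(t, \<xi>). conj_last f t \<xi>)"
    and "\<forall>r>0. (SUP (t, \<xi>)\<in>(\<Omega> \<times> \<Gamma>) \<times> {\<xi>. norm \<xi> < r}. \<bar>conj_last f t \<xi>\<bar>) < \<infinity>"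
    and "C1_on u \<Omega>" and "u ` \<Omega> \<subseteq> \<Gamma>"
    and "energy \<Omega> f u < \<infinity>"
  shows "lifted_functional \<Omega> \<Gamma> f (graph_measure \<Omega> \<Gamma> u) = enn2ereal (energy \<Omega> f u)"
proof -
  interpret graph_lifting \<Omega> \<Gamma> f u
    using assms by unfold_locales
  show ?thesis
    using lifted_functional_le energy_le_lifted_functional by (rule antisym)
qed

end
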